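(* Let $f_i:\mathbb{R}^n\to\mathbb{R}$, $i=1,\dots,d$, be twice differentiable functions. For each $i,j,l\in\{1,\dots,d\}$ define the functions $$T_{ij}(z):=\int_0^1 E\left[\sum_{k=1}^n\frac{\partial f_i}{\partial z_k}(z)\,\frac{\partial f_j}{\partial z_k}\big(\alpha z+\sqrt{1-\alpha^2}\,Z'\big)\right]d\alpha,\qquad z\in\mathbb{R}^n,$$ and $$T_{lij}(z):=\int_0^1 E\left[\sum_{k=1}^n\frac{\partial f_l}{\partial z_k}(z)\,\frac{\partial T_{ij}}{\partial z_k}\big(\alpha z+\sqrt{1-\alpha^2}\,Z'\big)\right]d\alpha,\qquad z\in\mathbb{R}^n.$$ Assume that (i) $E\left[\exp\left(-\sum_{i=1}^d\theta_i f_i(Z)\right)\right]<\infty$ for any $\theta_1,\dots,\theta_d\ge 0$, and all (first- and second-order partial) derivatives of the $f_i$ have subexponential growth at infinity; (ii) $T_{lij}(z)\ge 0$ for every $i,j,l\in\{1,\dots,d\}$ and every $z\in\mathbb{R}^n$. Let $\Sigma$ be the covariance matrix of $(f_1(Z),\dots,f_d(Z))$ and let $\|\cdot\|_{\rm op}$ denote the operator norm. Then, for any $t=(t_1,\dots,t_d)\in\mathbb{R}^d_+$, $$P\big(f_1(Z)-Ef_1(Z)\le -t_1,\ \dots,\ f_d(Z)-Ef_d(Z)\le -t_d\big)\le \exp\left(-\frac{t_1^2+\cdots+t_d^2}{2\|\Sigma\|_{\rm op}}\right).$$ Assume, further, that the inverse matrix $\Sigma^{-1}$ exists. Then $$P\big(f_1(Z)-Ef_1(Z)\le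 -t_1,\ \dots,\ f_d(Z)-Ef_d(Z)\le -t_d\big)\le \exp\left(-\frac12\, t\,\Sigma^{-1}\,t^{\intercal}\right)$$ for any $t=(t_1,\dots,t_d)\in\mathbb{R}^d$ satisfying $t\,\Sigma^{-1}\in\mathbb{R}^d_+$.
   Context: $Z=(Z_1,\dots,Z_n)$ is an $n$-dimensional standard Gaussian vector (independent $N(0,1)$ coordinates) and $Z'=(Z'_1,\dots,Z'_n)$ is an independent copy of $Z$. $\mathbb{R}_+=[0,\infty)$. Vectors $t\in\mathbb{R}^d$ are row vectors and $t^{\intercal}$ is the transpose of $t$. A function $g:\mathbb{R}^n\to\mathbb{R}$ has subexponential growth at infinity if for every $\varepsilon>0$ there is a constant $C_\varepsilon$ with $|g(z)|\le C_\varepsilon e^{\varepsilon|z|}$ for all $z\in\mathbb{R}^n$. The operator norm is the one induced by the Euclidean norm. *)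

theory Defs
  imports "HOL-Probability.Probability"
begin

definition partial_deriv :: "'n \<Rightarrow> (real ^ 'n \<Rightarrow> real) \<Rightarrow> real ^ 'n \<Rightarrow> real"
  where "partial_deriv k g z = deriv (\<lambda>h. g (z + h *\<^sub>R axis k 1)) 0"

(* Differentiability is total (Frechet) differentiability: g is differentiable everywhere, and
   so is its gradient, i.e. each of its first-order partial derivatives. The second derivatives
   need not be continuous. *)
definition twice_differentiable :: "(real ^ 'n \<Rightarrow> real) \<Rightarrow> bool"
  where "twice_differentiable g \<longleftrightarrow>
    g differentiable_on UNIV \<and> (\<forall>k. partial_deriv k g differentiable_on UNIV)"

definition subexponential_growth :: "(real ^ 'n \<Rightarrow> real) \<Rightarrow> bool"
  where "subexponential_growth g \<longleftrightarrow>
    (\<forall>\<epsilon>>0. \<exists>C. \<forall>z. \<bar>g z\<bar> \<le> C * exp (\<epsilon> * norm z))"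

definition std_gaussian_vector :: "'a measure \<Rightarrow> ('a \<Rightarrow> real ^ 'n) \<Rightarrow> bool"
  where "std_gaussian_vector M Z \<longleftrightarrow>
    prob_space.indep_vars M (\<lambda>_. borel) (\<lambda>k \<omega>. Z \<omega> $ k) UNIV \<and>
    (\<forall>k. distributed M lborel (\<lambda>\<omega>. Z \<omega> $ k) std_normal_density)"

definition covariance_matrix :: "'a measure \<Rightarrow> ('d \<Rightarrow> 'a \<Rightarrow> real) \<Rightarrow> real ^ 'd ^ 'd"
  where "covariance_matrix M X =
    (\<chi> i j. LINT \<omega>|M. (X i \<omega> - (LINT \<omega>'|M. X i \<omega>')) * (X j \<omega> - (LINT \<omega>'|M. X j \<omega>')))"

(* With W the independent Gaussian copy Z', the functions of the theorem are
   T_ij  = gaussian_T M W (f i) (f j)  and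
   T_lij = gaussian_T M W (f l) (gaussian_T M W (f i) (f j)). *)
definition gaussian_T ::
  "'a measure \<Rightarrow> ('a \<Rightarrow> real ^ 'n) \<Rightarrow> (real ^ 'n \<Rightarrow> real) \<Rightarrow> (real ^ 'n \<Rightarrow> real) \<Rightarrow> real ^ 'n \<Rightarrow> real"
  where "gaussian_T M W g h z =
    (LINT \<alpha>:{0..1}|lborel.
      (LINT \<omega>|M. (\<Sum>k\<in>UNIV. partial_deriv k g z *
         partial_deriv k h (\<alpha> *\<^sub>R z + sqrt (1 - \<alpha>\<^sup>2) *\<^sub>R W \<omega>))))"

end

theory Submission
  imports Defs
begin

text \<open>
  Fix weights \<open>\<theta>\<close> with nonnegative entries and put \<open>F = \<Sum>i. \<theta> i * (f i - E (f i))\<close>, evaluated at a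
  standard Gaussian vector. The whole theorem is Chernoff's inequality applied to the
  sub-Gaussian bound \<open>E (exp (- F)) \<le> exp (Var F / 2)\<close> for the lower exponential moments, where
  \<open>Var F = \<theta> \<bullet> (\<Sigma> *v \<theta>)\<close>: the choice \<open>\<theta> = t / onorm \<Sigma>\<close> gives the first estimate, letting
  \<open>\<theta>\<close> be a large multiple of \<open>t\<close> covers \<open>\<Sigma> = 0\<close>, and \<open>\<theta> = t v* matrix_inv \<Sigma>\<close>, which minimizes
  \<open>\<theta> \<bullet> (\<Sigma> *v \<theta>) / 2 - \<theta> \<bullet> t\<close>, gives the second.

  The exponential moment bound rests on the Gaussian covariance formula
  \<open>Cov (g, h) = E (T g h)\<close> (\<open>gaussian_covariance_formula\<close>), in which \<open>T g h\<close> pairs the gradient of \<open>g\<close>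
  at \<open>z\<close> with the gradient of \<open>h\<close> averaged along the arc from an independent copy to \<open>z\<close>;
  the functions \<open>T\<^sub>i\<^sub>j\<close> and \<open>T\<^sub>l\<^sub>i\<^sub>j\<close> of the theorem are \<open>T (f i) (f j)\<close> and \<open>T (f l) (T (f i) (f j))\<close>.
  Let \<open>\<phi> r = E (exp (- r * F))\<close>. The gradient of \<open>exp (- r * F)\<close> is
  \<open>- r * exp (- r * F)\<close> times that of \<open>F\<close>, so the formula yields
  \<open>\<phi>' r = r * (\<Sum>i j. \<theta> i * \<theta> j * E (exp (- r * F) * T\<^sub>i\<^sub>j))\<close>. It also yields
  \<open>Cov (exp (- r * F), T\<^sub>i\<^sub>j) = - r * (\<Sum>l. \<theta> l * E (exp (- r * F) * T\<^sub>l\<^sub>i\<^sub>j)) \<le> 0\<close>,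
  and this is where the positivity of \<open>T\<^sub>l\<^sub>i\<^sub>j\<close> and of \<open>\<theta>\<close> enters. Since \<open>E (T\<^sub>i\<^sub>j) = \<Sigma>\<^sub>i\<^sub>j\<close> by the
  formula once more, \<open>\<phi>' r \<le> r * Var F * \<phi> r\<close>, and integrating from \<open>0\<close> to \<open>1\<close> finishes
  (\<open>lower_mgf_bound\<close>).

  The covariance formula itself is proved by rotating: with \<open>W\<^sub>s = sin s *\<^sub>R x + cos s *\<^sub>R y\<close> for
  independent Gaussian \<open>x\<close> and \<open>y\<close>, the difference \<open>h x - h y\<close> is the integral over the quarter circle of the
  \<open>s\<close>-derivative of \<open>h W\<^sub>s\<close>. That derivative involves the factor \<open>cos s * x $ k - sin s * y $ k\<close>, the
  inner product of \<open>(x, y)\<close> with the direction \<open>(cos s *\<^sub>R e\<^sub>k, - sin s *\<^sub>R e\<^sub>k)\<close>, along which \<open>W\<^sub>s\<close> is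
  constant. Gaussian integration by parts in this direction therefore differentiates \<open>g x\<close> only, and
  the derivatives of \<open>h\<close> enter to first order only. This matters because the formula is
  applied to \<open>h = T\<^sub>i\<^sub>j\<close>, which is differentiable once.
\<close>


section \<open>The standard Gaussian measure on a Euclidean space\<close>

definition gauss_density :: "'e::euclidean_space \<Rightarrow> real" where
  "gauss_density x = (\<Prod>b\<in>Basis. std_normal_density (x \<bullet> b))"

definition gauss_measure :: "'e::euclidean_space measure" where
  "gauss_measure = density lborel (\<lambda>x. ennreal (gauss_density x))"

lemma norm_sq_Basis: "(norm x)\<^sup>2 = (\<Sum>b\<in>Basis. (x \<bullet> b)\<^sup>2)" for x :: "'e::euclidean_space"
  unfolding power2_norm_eq_inner euclidean_inner[of x x] by (simp add: power2_eq_square)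

lemma gauss_density_exp:
  "gauss_density x = (1 / sqrt (2 * pi)) ^ DIM('e) * exp (- (norm x)\<^sup>2 / 2)" for x :: "'e::euclidean_space"
proof -
  have "(\<Sum>b\<in>Basis. - (x \<bullet> b)\<^sup>2 / 2) = - (norm x)\<^sup>2 / 2"
    by (simp add: norm_sq_Basis sum_negf sum_divide_distrib[symmetric])
  then show ?thesis
    by (simp add: gauss_density_def std_normal_density_def prod_dividef exp_sum[symmetric] power_one_over)
qed

lemma gauss_density_pos: "0 < gauss_density x"
  by (simp add: gauss_density_def normal_density_pos prod_pos)

lemma gauss_density_measurable[measurable]: "gauss_density \<in> borel_measurable borel"
  unfolding gauss_density_def by measurable

lemma gauss_density_Pair: "gauss_density (x, y) = gauss_density x * gauss_density y"
  by (simp add: gauss_density_exp norm_Pair power_add exp_add[symmetric] add_divide_distrib)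

lemma sets_gauss_measure[simp, measurable_cong]: "sets gauss_measure = sets borel"
  by (simp add: gauss_measure_def)

lemma space_gauss_measure[simp]: "space gauss_measure = UNIV"
  by (simp add: gauss_measure_def)

lemma prob_space_gauss_measure: "prob_space (gauss_measure :: 'e::euclidean_space measure)"
proof
  have "emeasure gauss_measure (UNIV :: 'e set) =
      (\<integral>\<^sup>+x. (\<Prod>b\<in>Basis. ennreal (std_normal_density (x \<bullet> b))) \<partial>(lborel::'e measure))"
    by (simp add: gauss_measure_def emeasure_density gauss_density_def prod_ennreal)
  also have "\<dots> = (\<Prod>b\<in>(Basis::'e set). (\<integral>\<^sup>+x. std_normal_density x \<partial>lborel))"
    by (rule nn_integral_lborel_prod) auto
  also have "(\<integral>\<^sup>+x. std_normal_density x \<partial>lborel) = 1"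
    using prob_space.emeasure_space_1[OF prob_space_normal_density[of 1 0]]
    by (simp add: emeasure_density)
  finally show "emeasure gauss_measure (space (gauss_measure :: 'e measure)) = 1" by simp
qed

text \<open>
  A pair of independent standard Gaussian vectors is itself a standard Gaussian vector on the product
  space. This lets integration by parts mix the coordinates of the two vectors.
\<close>

lemma gauss_measure_pair:
  "gauss_measure \<Otimes>\<^sub>M gauss_measure = (gauss_measure :: ('a::euclidean_space \<times> 'b::euclidean_space) measure)"
proof -
  interpret prob_space "gauss_measure :: 'b measure" by (rule prob_space_gauss_measure)
  have [measurable]: "(\<lambda>(x::'a, y::'b). ennreal (gauss_density x) * ennreal (gauss_density y)) \<in> borel_measurable borel"
    unfolding borel_prod[symmetric] by measurable
  show ?thesis
    using sigma_finite_measure_axioms unfolding gauss_measure_def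
    by (subst pair_measure_density)
       (auto simp: lborel_prod lborel.sigma_finite_measure_axioms gauss_density_Pair ennreal_mult
          gauss_density_pos less_imp_le intro!: density_cong)
qed

lemma integral_gauss_measure:
  fixes f :: "'e::euclidean_space \<Rightarrow> real"
  assumes [measurable]: "f \<in> borel_measurable borel"
  shows "integral\<^sup>L gauss_measure f = integral\<^sup>L lborel (\<lambda>x. gauss_density x * f x)"
  by (simp add: gauss_measure_def integral_density gauss_density_pos less_imp_le)

lemma integrable_gauss_measure:
  fixes f :: "'e::euclidean_space \<Rightarrow> real"
  assumes [measurable]: "f \<in> borel_measurable borel"
  shows "integrable gauss_measure f \<longleftrightarrow> integrable lborel (\<lambda>x. gauss_density x * f x)"
  by (simp add: gauss_measure_def integrable_density gauss_density_pos less_imp_le)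

lemma prod_Basis_vec: "(\<Prod>b\<in>(Basis :: (real^'n) set). F b) = (\<Prod>k\<in>UNIV. F (axis k 1))"
proof -
  have B: "(Basis :: (real^'n) set) = range (\<lambda>k. axis k 1)" by (auto simp: Basis_vec_def)
  show ?thesis unfolding B by (subst prod.reindex) (auto simp: inj_on_def axis_eq_axis)
qed

text \<open>
  Dividing the law of \<open>Z\<close> by the Gaussian density should give back Lebesgue measure, which is
  characterized by its values on boxes. On a box the indicator over the density is a product of functions of
  single coordinates, so independence reduces the claim to the one-dimensional densities.
\<close>

lemma std_gaussian_vector_distr:
  fixes Z :: "'a \<Rightarrow> real ^ 'n"
  assumes "prob_space M" and Z: "std_gaussian_vector M Z"
  shows "Z \<in> borel_measurable M" "distr M borel Z = gauss_measure"
proof -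
  interpret prob_space M by fact
  have ind: "indep_vars (\<lambda>_. borel) (\<lambda>k \<omega>. Z \<omega> $ k) UNIV"
    and D: "\<And>k. distributed M lborel (\<lambda>\<omega>. Z \<omega> $ k) std_normal_density"
    using Z by (auto simp: std_gaussian_vector_def)
  have [measurable]: "(\<lambda>\<omega>. Z \<omega> $ k) \<in> borel_measurable M" for k
    using distributed_measurable[OF D] by simp
  show Z[measurable]: "Z \<in> borel_measurable M"
    by (subst borel_measurable_euclidean_space) (auto simp: Basis_vec_def inner_axis)
  have dens: "gauss_density z = (\<Prod>k\<in>UNIV. std_normal_density (z $ k))" for z :: "real^'n"
    by (simp add: gauss_density_def prod_Basis_vec inner_axis)
  define W where "W = density (distr M borel Z) (\<lambda>z. ennreal (1 / gauss_density z))"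
  have "lborel = W"
  proof (rule lborel_eqI)
    fix l u :: "real^'n" assume "\<And>b. b \<in> Basis \<Longrightarrow> l \<bullet> b \<le> u \<bullet> b"
    from this[of "axis k 1" for k] have lu: "l $ k \<le> u $ k" for k
      by (auto simp: Basis_vec_def inner_axis)
    define h where "h k x = indicator {l$k<..<u$k} x / std_normal_density x" for k x
    have h_nonneg: "0 \<le> h k x" for k x by (auto simp: h_def)
    have [measurable]: "h k \<in> borel_measurable borel" for k by (auto simp: h_def[abs_def])
    have box: "indicator (box l u) z / gauss_density z = (\<Prod>k\<in>UNIV. h k (z $ k))" for z
      by (auto simp: h_def dens prod_dividef mem_box_cart prod_pos indicator_def split: if_splits)
    have "emeasure W (box l u) = (\<integral>\<^sup>+\<omega>. ennreal (1 / gauss_density (Z \<omega>)) * indicator (box l u) (Z \<omega>) \<partial>M)"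
      by (simp add: W_def emeasure_density nn_integral_distr)
    also have "\<dots> = (\<integral>\<^sup>+\<omega>. (\<Prod>k\<in>UNIV. h k (Z \<omega> $ k)) \<partial>M)"
      by (intro nn_integral_cong) (auto simp: box[symmetric] indicator_def)
    also have "\<dots> = (\<integral>\<^sup>+\<omega>. (\<Prod>k\<in>UNIV. ennreal (h k (Z \<omega> $ k))) \<partial>M)"
      by (simp add: prod_ennreal h_nonneg)
    also have "\<dots> = (\<Prod>k\<in>UNIV. \<integral>\<^sup>+\<omega>. h k (Z \<omega> $ k) \<partial>M)"
    proof (rule indep_vars_nn_integral)
      show "indep_vars (\<lambda>_. borel) (\<lambda>k \<omega>. ennreal (h k (Z \<omega> $ k))) UNIV"
        using indep_vars_compose[OF ind, of "\<lambda>k x. ennreal (h k x)" "\<lambda>_. borel"] by (simp add: o_def)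
    qed auto
    also have "\<dots> = (\<Prod>k\<in>UNIV. ennreal (u $ k - l $ k))"
    proof (intro prod.cong refl)
      fix k
      have "(\<integral>\<^sup>+\<omega>. h k (Z \<omega> $ k) \<partial>M) = (\<integral>\<^sup>+x. std_normal_density x * ennreal (h k x) \<partial>lborel)"
        by (rule distributed_nn_integral[OF D, symmetric]) auto
      also have "\<dots> = (\<integral>\<^sup>+x. indicator {l$k<..<u$k} x \<partial>lborel)"
        by (intro nn_integral_cong)
           (auto simp: h_def ennreal_mult'[symmetric] indicator_def normal_density_pos less_imp_neq[symmetric])
      finally show "(\<integral>\<^sup>+\<omega>. h k (Z \<omega> $ k) \<partial>M) = ennreal (u $ k - l $ k)"
        using lu by simp
    qed
    also have "\<dots> = ennreal (\<Prod>b\<in>Basis. (u - l) \<bullet> b)"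
      by (simp add: prod_Basis_vec inner_axis prod_ennreal lu)
    finally show "emeasure W (box l u) = (\<Prod>b\<in>Basis. (u - l) \<bullet> b)" .
  qed (simp add: W_def)
  then have "gauss_measure = density W gauss_density" by (simp add: gauss_measure_def)
  also have "\<dots> = density (distr M borel Z) (\<lambda>z. ennreal (1 / gauss_density z) * ennreal (gauss_density z))"
    unfolding W_def by (rule density_density_eq) auto
  also have "\<dots> = distr M borel Z"
    by (subst density_cong[where f'="\<lambda>_. 1"])
       (auto simp: ennreal_mult'[symmetric] gauss_density_pos less_imp_le density_1 less_imp_neq[OF gauss_density_pos, symmetric])
  finally show "distr M borel Z = gauss_measure" by simp
qed

text \<open>
  Completing the square, \<open>a * s \<le> a\<^sup>2 + s\<^sup>2 / 4\<close>, dominates the weighted density by a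
  multiple of the Gaussian density of variance 2, which is again a product over coordinates.
\<close>

lemma integrable_exp_norm_gauss:
  "integrable gauss_measure (\<lambda>x::'e::euclidean_space. exp (a * norm x))"
proof -
  define c where "c = (1 / sqrt (2 * pi)) ^ DIM('e)"
  define c' where "c' = (1 / sqrt (2 * pi * 2)) ^ DIM('e)"
  have c: "0 < c" "0 < c'" by (auto simp: c_def c'_def)
  have nd: "(\<Prod>b\<in>Basis. normal_density 0 (sqrt 2) (x \<bullet> b)) = c' * exp (- (norm x)\<^sup>2 / 4)" for x :: 'e
  proof -
    have "(\<Sum>b\<in>Basis. - (x \<bullet> b)\<^sup>2 / 4) = - (norm x)\<^sup>2 / 4"
      by (simp add: norm_sq_Basis sum_negf sum_divide_distrib[symmetric])
    then show ?thesis
      by (simp add: normal_density_def prod_dividef exp_sum[symmetric] power_one_over c'_def)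
  qed
  have bound: "gauss_density x * exp (a * norm x)
      \<le> c / c' * exp (a\<^sup>2) * (\<Prod>b\<in>Basis. normal_density 0 (sqrt 2) (x \<bullet> b))" for x :: 'e
  proof -
    have "0 \<le> (norm x / 2 - a)\<^sup>2" by simp
    then have "- (norm x)\<^sup>2 / 2 + a * norm x \<le> a\<^sup>2 + - (norm x)\<^sup>2 / 4"
      by (simp add: power2_eq_square algebra_simps)
    then have "exp (- (norm x)\<^sup>2 / 2) * exp (a * norm x) \<le> exp (a\<^sup>2) * exp (- (norm x)\<^sup>2 / 4)"
      by (simp add: exp_add[symmetric])
    then have "c * (exp (- (norm x)\<^sup>2 / 2) * exp (a * norm x)) \<le> c * (exp (a\<^sup>2) * exp (- (norm x)\<^sup>2 / 4))"
      using c by (intro mult_left_mono) auto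
    then show ?thesis using c by (simp add: nd gauss_density_exp c_def[symmetric])
  qed
  have "integrable lborel (\<lambda>x::'e. \<Prod>b\<in>Basis. normal_density 0 (sqrt 2) (x \<bullet> b))"
  proof (rule integrableI_nonneg)
    have "(\<integral>\<^sup>+x. (\<Prod>b\<in>Basis. ennreal (normal_density 0 (sqrt 2) (x \<bullet> b))) \<partial>(lborel::'e measure)) =
       (\<Prod>b\<in>(Basis::'e set). (\<integral>\<^sup>+x. normal_density 0 (sqrt 2) x \<partial>lborel))"
      by (rule nn_integral_lborel_prod) auto
    also have "(\<integral>\<^sup>+x. normal_density 0 (sqrt 2) x \<partial>lborel) = 1"
      using prob_space.emeasure_space_1[OF prob_space_normal_density[of "sqrt 2" 0]]
      by (simp add: emeasure_density)
    finally show "(\<integral>\<^sup>+x. ennreal (\<Prod>b\<in>Basis. normal_density 0 (sqrt 2) (x \<bullet> b)) \<partial>(lborel::'e measure)) < \<infinity>"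
      by (simp add: prod_ennreal)
  qed (auto intro!: prod_nonneg)
  then have "integrable lborel (\<lambda>x::'e. c / c' * exp (a\<^sup>2) * (\<Prod>b\<in>Basis. normal_density 0 (sqrt 2) (x \<bullet> b)))"
    by simp
  then have "integrable lborel (\<lambda>x::'e. gauss_density x * exp (a * norm x))"
  proof (rule Bochner_Integration.integrable_bound)
    show "AE x in (lborel::'e measure). norm (gauss_density x * exp (a * norm x))
        \<le> norm (c / c' * exp (a\<^sup>2) * (\<Prod>b\<in>Basis. normal_density 0 (sqrt 2) (x \<bullet> b)))"
    proof (rule AE_I2)
      fix x :: 'e
      have "norm (gauss_density x * exp (a * norm x)) = gauss_density x * exp (a * norm x)"
        by (simp add: abs_mult abs_of_pos[OF gauss_density_pos])
      also note bound
      finally show "norm (gauss_density x * exp (a * norm x))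
          \<le> norm (c / c' * exp (a\<^sup>2) * (\<Prod>b\<in>Basis. normal_density 0 (sqrt 2) (x \<bullet> b)))"
        unfolding real_norm_def by (rule order_trans[OF _ abs_ge_self])
    qed
  qed auto
  then show ?thesis by (simp add: integrable_gauss_measure)
qed

section \<open>Gaussian integration by parts\<close>

text \<open>
  The fundamental theorem of calculus for everywhere differentiable functions produces a gauge
  integral; once the derivative is known to be Lebesgue integrable, both integrals agree.
\<close>

lemma integral_interval_FTC:
  fixes F :: "real \<Rightarrow> real"
  assumes "a \<le> b" and F: "\<And>r. (F has_real_derivative F' r) (at r)"
    and int: "integrable (density lborel (\<lambda>r. ennreal (indicator {a..b} r))) F'"
  shows "integral\<^sup>L (density lborel (\<lambda>r. ennreal (indicator {a..b} r))) F' = F b - F a"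
proof -
  have [measurable]: "F' \<in> borel_measurable borel" using int by auto
  have i: "integrable lborel (\<lambda>r. indicator {a..b} r * F' r)"
    using int by (simp add: integrable_density)
  have "(F' has_integral (F b - F a)) {a..b}"
    by (rule fundamental_theorem_of_calculus)
       (use \<open>a \<le> b\<close> in \<open>auto simp: has_real_derivative_iff_has_vector_derivative[symmetric]
          intro!: has_field_derivative_at_within F\<close>)
  then have "((\<lambda>r. indicator {a..b} r * F' r) has_integral (F b - F a)) UNIV"
    by (subst (asm) has_integral_restrict_UNIV[symmetric])
       (simp add: indicator_def if_distrib[of "\<lambda>c. c * _"] of_bool_def cong: if_cong)
  with has_integral_integral_real[OF i]
  have "(\<integral>r. indicator {a..b} r * F' r \<partial>lborel) = F b - F a"
    by (rule has_integral_unique)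
  then show ?thesis
    by (simp add: integral_density)
qed

text \<open>
  Translation invariance gives \<open>\<integral> K (x + u) - K x = 0\<close>. Writing the increment as the integral of \<open>D\<close>
  over the segment from \<open>x\<close> to \<open>x + u\<close> and exchanging the integrals turns the left-hand side into
  \<open>\<integral> D\<close>, again by translation invariance. Fubini's theorem makes \<open>D\<close> integrable on almost every
  such segment, as the fundamental theorem of calculus requires.
\<close>

lemma integral_derivative_eq_0:
  fixes K D :: "'e::euclidean_space \<Rightarrow> real"
  assumes K: "integrable lborel K" and D: "integrable lborel D"
    and der: "\<And>x. ((\<lambda>r. K (x + r *\<^sub>R u)) has_real_derivative D x) (at 0)"
  shows "integral\<^sup>L lborel D = 0"
proof -
  have [measurable]: "K \<in> borel_measurable borel" "D \<in> borel_measurable borel"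
    using K D by auto
  have tr: "integrable lborel (\<lambda>x. f (x + v)) \<and> (\<integral>x. f (x + v) \<partial>lborel) = integral\<^sup>L lborel f"
    if f: "integrable lborel f" for f :: "'e \<Rightarrow> real" and v
  proof -
    have [measurable]: "f \<in> borel_measurable borel" using f by auto
    have e: "lborel = distr lborel borel (\<lambda>x. x + v)"
      using lborel_distr_plus[of v] by (simp add: add.commute[of _ v])
    have "integrable (distr lborel borel (\<lambda>x. x + v)) f" using f e by simp
    then have "integrable lborel (\<lambda>x. f (x + v))" by (simp add: integrable_distr_eq)
    moreover have "integral\<^sup>L lborel f = integral\<^sup>L (distr lborel borel (\<lambda>x. x + v)) f" using e by simp
    ultimately show ?thesis by (simp add: integral_distr)
  qed
  define I :: "real measure" where "I = density lborel (\<lambda>r. ennreal (indicator {0..1} r))"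
  have [measurable_cong]: "sets I = sets borel" by (simp add: I_def)
  have "emeasure I UNIV = 1" by (simp add: I_def emeasure_density ennreal_indicator)
  then interpret I: prob_space I by (intro prob_spaceI) (simp add: I_def)
  interpret pair_sigma_finite I "lborel :: 'e measure" ..
  have int_D: "integrable (I \<Otimes>\<^sub>M lborel) (\<lambda>(r, x). D (x + r *\<^sub>R u))"
  proof (rule Fubini_integrable)
    have "integrable lborel (\<lambda>x. norm (D x))" using D by simp
    then show "integrable I (\<lambda>r. \<integral>x. norm (case (r, x) of (r, x) \<Rightarrow> D (x + r *\<^sub>R u)) \<partial>lborel)"
      using tr[of "\<lambda>x. norm (D x)"] by simp
  qed (use tr[OF D] in auto)
  have line: "((\<lambda>r. K (x + r *\<^sub>R u)) has_real_derivative D (x + r *\<^sub>R u)) (at r)" for x r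
  proof -
    have "((\<lambda>s. K ((x + r *\<^sub>R u) + s *\<^sub>R u)) has_real_derivative D (x + r *\<^sub>R u)) (at 0)" by (rule der)
    then show ?thesis
      by (subst (2) add_0[symmetric, of r], subst DERIV_shift) (simp add: algebra_simps)
  qed
  have "AE x in lborel. integrable I (\<lambda>r. D (x + r *\<^sub>R u))"
    using AE_integrable_snd[OF int_D] by simp
  then have "AE x in lborel. (\<integral>r. D (x + r *\<^sub>R u) \<partial>I) = K (x + u) - K x"
  proof eventually_elim
    fix x assume "integrable I (\<lambda>r. D (x + r *\<^sub>R u))"
    then show "(\<integral>r. D (x + r *\<^sub>R u) \<partial>I) = K (x + u) - K x"
      using integral_interval_FTC[of 0 1, OF _ line, of x] by (simp add: I_def)
  qed
  moreover have "(\<lambda>x. \<integral>r. D (x + r *\<^sub>R u) \<partial>I) \<in> borel_measurable lborel"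
    using integrable_snd[OF int_D] by (rule borel_measurable_integrable)
  ultimately have "(\<integral>x. (\<integral>r. D (x + r *\<^sub>R u) \<partial>I) \<partial>lborel) = (\<integral>x. K (x + u) - K x \<partial>lborel)"
    by (intro integral_cong_AE) measurable
  also have "\<dots> = 0"
    using Bochner_Integration.integral_diff[OF conjunct1[OF tr[OF K, of u]] K] conjunct2[OF tr[OF K, of u]] by simp
  also have "(\<integral>x. (\<integral>r. D (x + r *\<^sub>R u) \<partial>I) \<partial>lborel) = (\<integral>r. (\<integral>x. D (x + r *\<^sub>R u) \<partial>lborel) \<partial>I)"
    by (rule trans[OF integral_snd[OF int_D] integral_fst[OF int_D, symmetric]])
  also have "\<dots> = integral\<^sup>L lborel D"
    by (subst conjunct2[OF tr[OF D]]) (simp add: I.prob_space)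
  finally show ?thesis .
qed

text \<open>
  The directional derivative of \<open>gauss_density x * G x\<close> is
  \<open>gauss_density x * (D x - (x \<bullet> u) * G x)\<close>, and it has integral 0.
\<close>

lemma gaussian_integration_by_parts:
  fixes G D :: "'e::euclidean_space \<Rightarrow> real"
  assumes G: "integrable gauss_measure G" and D: "integrable gauss_measure D"
    and uG: "integrable gauss_measure (\<lambda>x. (x \<bullet> u) * G x)"
    and der: "\<And>x. ((\<lambda>r. G (x + r *\<^sub>R u)) has_real_derivative D x) (at 0)"
  shows "(\<integral>x. (x \<bullet> u) * G x \<partial>gauss_measure) = integral\<^sup>L gauss_measure D"
proof -
  have [measurable]: "G \<in> borel_measurable borel" "D \<in> borel_measurable borel"
    using G D by auto
  have dens: "((\<lambda>r. gauss_density (x + r *\<^sub>R u)) has_real_derivative - (x \<bullet> u) * gauss_density x) (at 0)" for x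
  proof -
    have n: "(norm (x + r *\<^sub>R u))\<^sup>2 = (norm x)\<^sup>2 + 2 * r * (x \<bullet> u) + r\<^sup>2 * (u \<bullet> u)" for r
      unfolding power2_norm_eq_inner by (simp add: inner_simps algebra_simps power2_eq_square inner_commute)
    have e: "gauss_density (x + r *\<^sub>R u) = gauss_density x * exp (- (r * (x \<bullet> u)) - r\<^sup>2 * (u \<bullet> u) / 2)" for r
      by (simp add: gauss_density_exp exp_add[symmetric] n add_divide_distrib)
    show ?thesis unfolding e by (auto intro!: derivative_eq_intros)
  qed
  have "(\<integral>x. gauss_density x * D x - gauss_density x * ((x \<bullet> u) * G x) \<partial>lborel) = 0"
  proof (rule integral_derivative_eq_0)
    show "((\<lambda>r. gauss_density (x + r *\<^sub>R u) * G (x + r *\<^sub>R u)) has_real_derivative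
        gauss_density x * D x - gauss_density x * ((x \<bullet> u) * G x)) (at 0)" for x
      using DERIV_mult[OF dens der, of x] by (simp add: algebra_simps)
  qed (use G D uG in \<open>auto simp: integrable_gauss_measure\<close>)
  then show ?thesis
    using G D uG by (simp add: integrable_gauss_measure integral_gauss_measure)
qed

section \<open>Differentiation under the integral sign\<close>

text \<open>
  By the mean value inequality the difference quotients minus their limit are at most \<open>2 * B\<close>, so
  dominated convergence applies. The statement within a convex set \<open>S\<close> covers both uses below: a
  closed ball around a point, where a growth bound on the derivative is uniform, and the interval
  \<open>{0..1}\<close> with one-sided derivatives at its end points.
\<close>

lemma has_derivative_integral_dominated:
  fixes H :: "'z::euclidean_space \<Rightarrow> 'a \<Rightarrow> real"
  assumes S: "convex S" "z0 \<in> S"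
    and int: "\<And>z. z \<in> S \<Longrightarrow> integrable N (H z)"
    and der: "\<And>z \<omega>. z \<in> S \<Longrightarrow> ((\<lambda>z. H z \<omega>) has_derivative H' z \<omega>) (at z within S)"
    and bound: "\<And>z \<omega>. z \<in> S \<Longrightarrow> onorm (H' z \<omega>) \<le> B \<omega>"
    and B: "integrable N B"
    and meas: "\<And>u. (\<lambda>\<omega>. H' z0 \<omega> u) \<in> borel_measurable N"
  shows "((\<lambda>z. \<integral>\<omega>. H z \<omega> \<partial>N) has_derivative (\<lambda>u. \<integral>\<omega>. H' z0 \<omega> u \<partial>N)) (at z0 within S)"
proof -
  have bl: "bounded_linear (H' z0 \<omega>)" for \<omega>
    using der[OF S(2)] has_derivative_bounded_linear by blast
  have le: "\<bar>H' z0 \<omega> u\<bar> \<le> B \<omega> * norm u" for \<omega> u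
    using onorm[OF bl[of \<omega>], of u] mult_right_mono[OF bound[OF S(2), of \<omega>], of "norm u"] by simp
  have B0: "0 \<le> B \<omega>" for \<omega>
    using onorm_pos_le[OF bl[of \<omega>]] bound[OF S(2), of \<omega>] by linarith
  have i: "integrable N (\<lambda>\<omega>. H' z0 \<omega> u)" for u
    by (rule Bochner_Integration.integrable_bound[of N "\<lambda>\<omega>. B \<omega> * norm u"])
       (use B meas le B0 in \<open>auto simp: abs_mult\<close>)
  have "linear (\<lambda>u. \<integral>\<omega>. H' z0 \<omega> u \<partial>N)"
    by (rule linearI)
       (simp_all add: i linear_add[OF bounded_linear.linear[OF bl]] linear_scale[OF bounded_linear.linear[OF bl]])
  moreover
  have "((\<lambda>z. norm ((\<integral>\<omega>. H z \<omega> \<partial>N) - (\<integral>\<omega>. H z0 \<omega> \<partial>N) - (\<integral>\<omega>. H' z0 \<omega> (z - z0) \<partial>N)) / norm (z - z0)) \<longlongrightarrow> 0)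
      (at z0 within S)"
    unfolding tendsto_at_iff_sequentially o_def
  proof (intro allI impI)
    fix X assume X: "\<forall>n. X n \<in> S - {z0}" "X \<longlonglongrightarrow> z0"
    define D where "D n \<omega> = (H (X n) \<omega> - H z0 \<omega> - H' z0 \<omega> (X n - z0)) / norm (X n - z0)" for n \<omega>
    have Xn: "X n \<in> S" "norm (X n - z0) > 0" for n using X(1) by auto
    have ID: "integral\<^sup>L N (D n) =
       ((\<integral>\<omega>. H (X n) \<omega> \<partial>N) - (\<integral>\<omega>. H z0 \<omega> \<partial>N) - (\<integral>\<omega>. H' z0 \<omega> (X n - z0) \<partial>N)) / norm (X n - z0)" for n
      unfolding D_def by (simp add: i int[OF Xn(1)] int[OF S(2)])
    have "(\<lambda>n. integral\<^sup>L N (D n)) \<longlonglongrightarrow> integral\<^sup>L N (\<lambda>_. 0)"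
    proof (rule integral_dominated_convergence)
      show "integrable N (\<lambda>\<omega>. 2 * B \<omega>)" using B by simp
      show "D n \<in> borel_measurable N" for n
        unfolding D_def
        by (intro borel_measurable_divide borel_measurable_diff borel_measurable_const
              borel_measurable_integrable[OF int] borel_measurable_integrable[OF i] Xn S)
      show "AE \<omega> in N. norm (D n \<omega>) \<le> 2 * B \<omega>" for n
      proof (rule AE_I2)
        fix \<omega>
        have "norm (H (X n) \<omega> - H z0 \<omega>) \<le> B \<omega> * norm (X n - z0)"
          by (rule differentiable_bound[OF S(1) der bound]) (use Xn S in auto)
        then have "\<bar>H (X n) \<omega> - H z0 \<omega> - H' z0 \<omega> (X n - z0)\<bar> \<le> 2 * B \<omega> * norm (X n - z0)"
          using le[of \<omega> "X n - z0"] by simp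
        then show "norm (D n \<omega>) \<le> 2 * B \<omega>"
          unfolding D_def real_norm_def abs_divide abs_norm_cancel pos_divide_le_eq[OF Xn(2)] .
      qed
      show "AE \<omega> in N. (\<lambda>n. D n \<omega>) \<longlonglongrightarrow> 0"
      proof (rule AE_I2)
        fix \<omega>
        have "(\<lambda>n. norm (H (X n) \<omega> - H z0 \<omega> - H' z0 \<omega> (X n - z0)) / norm (X n - z0)) \<longlonglongrightarrow> 0"
          using der[OF S(2), of \<omega>] X(1,2) unfolding has_derivative_iff_norm tendsto_at_iff_sequentially o_def
          by (elim conjE allE[of _ X]) simp
        then show "(\<lambda>n. D n \<omega>) \<longlonglongrightarrow> 0"
          by (intro tendsto_norm_zero_cancel[of "\<lambda>n. D n \<omega>"]) (simp add: D_def)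
      qed
    qed simp
    then have "(\<lambda>n. norm (integral\<^sup>L N (D n))) \<longlonglongrightarrow> 0"
      by (intro tendsto_norm_zero) simp
    then show "(\<lambda>n. norm ((\<integral>\<omega>. H (X n) \<omega> \<partial>N) - (\<integral>\<omega>. H z0 \<omega> \<partial>N) - (\<integral>\<omega>. H' z0 \<omega> (X n - z0) \<partial>N)) / norm (X n - z0)) \<longlonglongrightarrow> 0"
      by (simp add: ID)
  qed
  ultimately show ?thesis
    by (simp add: has_derivative_iff_norm linear_conv_bounded_linear)
qed

section \<open>Partial derivatives and subexponential growth\<close>

lemma has_derivative_partial_deriv:
  fixes g :: "real ^ 'n \<Rightarrow> real"
  assumes "g differentiable (at z)"
  shows "(g has_derivative (\<lambda>v. \<Sum>k\<in>UNIV. v $ k * partial_deriv k g z)) (at z)"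
proof -
  obtain g' where g': "(g has_derivative g') (at z)" using assms by (auto simp: differentiable_def)
  interpret bounded_linear g' using g' by (rule has_derivative_bounded_linear)
  have pd: "partial_deriv k g z = g' (axis k 1)" for k
  proof -
    have "((\<lambda>h. g (z + h *\<^sub>R axis k 1)) has_derivative (\<lambda>h. g' (h *\<^sub>R axis k 1))) (at 0)"
      by (rule has_derivative_compose[where g=g and f="\<lambda>h. z + h *\<^sub>R axis k 1"])
         (use g' in \<open>auto intro!: derivative_eq_intros\<close>)
    then have "((\<lambda>h. g (z + h *\<^sub>R axis k 1)) has_real_derivative g' (axis k 1)) (at 0)"
      by (rule has_derivative_imp_has_field_derivative) (simp add: scaleR)
    then show ?thesis unfolding partial_deriv_def by (rule DERIV_imp_deriv)
  qed
  have rep: "g' v = (\<Sum>k\<in>UNIV. v $ k * g' (axis k 1))" for v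
  proof -
    have "g' v = g' (\<Sum>k\<in>UNIV. v $ k *\<^sub>R axis k 1)"
      by (simp only: basis_expansion[of v, unfolded scalar_mult_eq_scaleR])
    then show ?thesis by (simp add: sum scaleR)
  qed
  have "g' = (\<lambda>v. \<Sum>k\<in>UNIV. v $ k * partial_deriv k g z)"
    by (rule ext) (subst rep, simp only: pd)
  with g' show ?thesis by simp
qed

lemma partial_deriv_eqI:
  fixes g :: "real ^ 'n \<Rightarrow> real"
  assumes "(g has_derivative g') (at z)"
  shows "partial_deriv k g z = g' (axis k 1)"
proof -
  have "g differentiable (at z)" using assms by (auto simp: differentiable_def)
  from has_derivative_unique[OF assms has_derivative_partial_deriv[OF this]]
  show ?thesis by (simp add: axis_def if_distrib[of "\<lambda>c. c * _"] cong: if_cong)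
qed

lemma has_real_derivative_partial_deriv:
  fixes g :: "real ^ 'n \<Rightarrow> real"
  assumes "g differentiable (at z)"
  shows "((\<lambda>h. g (z + h *\<^sub>R axis k 1)) has_real_derivative partial_deriv k g z) (at 0)"
proof -
  note g' = has_derivative_partial_deriv[OF assms]
  have "((\<lambda>h. g (z + h *\<^sub>R axis k 1)) has_derivative (\<lambda>h. \<Sum>j\<in>UNIV. (h *\<^sub>R axis k 1) $ j * partial_deriv j g z)) (at 0)"
    by (rule has_derivative_compose[where g=g and f="\<lambda>h. z + h *\<^sub>R axis k 1"])
       (use g' in \<open>auto intro!: derivative_eq_intros\<close>)
  then show ?thesis
    by (rule has_derivative_imp_has_field_derivative)
       (simp add: axis_def if_distrib[of "\<lambda>c. c * _"] if_distrib[of "\<lambda>c. _ * c"] cong: if_cong)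
qed

lemma differentiable_imp_borel_measurable:
  fixes g :: "'e::euclidean_space \<Rightarrow> real"
  assumes "\<And>z. g differentiable (at z)"
  shows "g \<in> borel_measurable borel"
  using assms by (intro borel_measurable_continuous_onI differentiable_imp_continuous_on)
    (auto simp: differentiable_on_def)

text \<open>
  A partial derivative is a pointwise limit of difference quotients with steps \<open>1 / Suc n\<close>.
\<close>

lemma borel_measurable_partial_deriv:
  fixes g :: "real ^ 'n \<Rightarrow> real"
  assumes g: "\<And>z. g differentiable (at z)"
  shows "partial_deriv k g \<in> borel_measurable borel"
proof (rule borel_measurable_LIMSEQ_real)
  fix z
  have "((\<lambda>h. (g (z + h *\<^sub>R axis k 1) - g z) / h) \<longlongrightarrow> partial_deriv k g z) (at 0)"
    using has_real_derivative_partial_deriv[OF g, of z k] by (simp add: DERIV_def)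
  moreover have "filterlim (\<lambda>n. 1 / real (Suc n)) (at 0) sequentially"
    unfolding filterlim_at using LIMSEQ_inverse_real_of_nat by (auto simp: field_simps)
  ultimately show "(\<lambda>n. (g (z + (1 / real (Suc n)) *\<^sub>R axis k 1) - g z) / (1 / real (Suc n))) \<longlonglongrightarrow> partial_deriv k g z"
    by (rule filterlim_compose)
next
  have [measurable]: "g \<in> borel_measurable borel" by (rule differentiable_imp_borel_measurable[OF g])
  show "(\<lambda>z. (g (z + (1 / real (Suc n)) *\<^sub>R axis k 1) - g z) / (1 / real (Suc n))) \<in> borel_measurable borel" for n
    by measurable
qed

lemma onorm_sum_mult_nth_le:
  "onorm (\<lambda>v :: real^'n. \<Sum>k\<in>UNIV. v $ k * c k) \<le> (\<Sum>k\<in>UNIV. \<bar>c k\<bar>)"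
proof (rule onorm_bound)
  fix v :: "real^'n"
  have "\<bar>\<Sum>k\<in>UNIV. v $ k * c k\<bar> \<le> (\<Sum>k\<in>UNIV. \<bar>v $ k\<bar> * \<bar>c k\<bar>)"
    by (rule order_trans[OF sum_abs]) (simp add: abs_mult)
  also have "\<dots> \<le> (\<Sum>k\<in>UNIV. norm v * \<bar>c k\<bar>)"
    by (intro sum_mono mult_right_mono component_le_norm_cart) auto
  finally show "norm (\<Sum>k\<in>UNIV. v $ k * c k) \<le> (\<Sum>k\<in>UNIV. \<bar>c k\<bar>) * norm v"
    by (simp add: sum_distrib_left[symmetric] mult.commute)
qed (simp add: sum_nonneg)

lemma subexponential_growthE:
  assumes "subexponential_growth g" "0 < \<epsilon>"
  obtains C where "0 \<le> C" "\<And>z. \<bar>g z\<bar> \<le> C * exp (\<epsilon> * norm z)"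
proof -
  obtain C where C: "\<And>z. \<bar>g z\<bar> \<le> C * exp (\<epsilon> * norm z)"
    using assms unfolding subexponential_growth_def by blast
  have "0 \<le> C" using order_trans[OF abs_ge_zero C, of 0] by simp
  then show thesis using C by (rule that)
qed

lemma subexponential_growth_familyE:
  assumes "\<And>k. subexponential_growth (g k)" "0 < \<epsilon>"
  obtains C where "\<And>k. 0 \<le> C k" "\<And>k z. \<bar>g k z\<bar> \<le> C k * exp (\<epsilon> * norm z)"
proof -
  have "\<forall>k. \<exists>C. 0 \<le> C \<and> (\<forall>z. \<bar>g k z\<bar> \<le> C * exp (\<epsilon> * norm z))"
  proof
    fix k show "\<exists>C. 0 \<le> C \<and> (\<forall>z. \<bar>g k z\<bar> \<le> C * exp (\<epsilon> * norm z))"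
      by (rule subexponential_growthE[OF assms]) blast
  qed
  from choice[OF this] show thesis using that by blast
qed

lemma subexponential_growth_add:
  assumes "subexponential_growth g" "subexponential_growth h"
  shows "subexponential_growth (\<lambda>z. g z + h z)"
  unfolding subexponential_growth_def
proof (intro allI impI)
  fix e :: real assume e: "0 < e"
  obtain C where C: "\<And>z. \<bar>g z\<bar> \<le> C * exp (e * norm z)" using subexponential_growthE[OF assms(1) e] by blast
  obtain D where D: "\<And>z. \<bar>h z\<bar> \<le> D * exp (e * norm z)" using subexponential_growthE[OF assms(2) e] by blast
  have "\<bar>g z + h z\<bar> \<le> (C + D) * exp (e * norm z)" for z
    using C[of z] D[of z] by (simp add: ring_distribs)
  then show "\<exists>C. \<forall>z. \<bar>g z + h z\<bar> \<le> C * exp (e * norm z)" by blast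
qed

lemma subexponential_growth_mult:
  assumes "subexponential_growth g" "subexponential_growth h"
  shows "subexponential_growth (\<lambda>z. g z * h z)"
  unfolding subexponential_growth_def
proof (intro allI impI)
  fix e :: real assume "0 < e"
  then have e: "0 < e / 2" by simp
  obtain C where C: "0 \<le> C" "\<And>z. \<bar>g z\<bar> \<le> C * exp (e / 2 * norm z)" using subexponential_growthE[OF assms(1) e] by blast
  obtain D where D: "\<And>z. \<bar>h z\<bar> \<le> D * exp (e / 2 * norm z)" using subexponential_growthE[OF assms(2) e] by blast
  have "\<bar>g z * h z\<bar> \<le> (C * D) * exp (e * norm z)" for z
  proof -
    have "\<bar>g z * h z\<bar> \<le> (C * exp (e / 2 * norm z)) * (D * exp (e / 2 * norm z))"
      unfolding abs_mult using C D by (intro mult_mono) auto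
    also have "\<dots> = (C * D) * exp (e / 2 * norm z + e / 2 * norm z)" unfolding exp_add by (simp add: ac_simps)
    finally show ?thesis by simp
  qed
  then show "\<exists>C. \<forall>z. \<bar>g z * h z\<bar> \<le> C * exp (e * norm z)" by blast
qed

lemma subexponential_growth_const: "subexponential_growth (\<lambda>_ :: real^'n. c)"
  unfolding subexponential_growth_def
proof (intro allI impI)
  fix e :: real assume "0 < e"
  then have "\<bar>c\<bar> * 1 \<le> \<bar>c\<bar> * exp (e * norm z)" for z :: "real^'n"
    by (intro mult_left_mono) auto
  then show "\<exists>C. \<forall>z::real^'n. \<bar>c\<bar> \<le> C * exp (e * norm z)" by auto
qed

lemma subexponential_growth_sum:
  "(\<And>i. i \<in> I \<Longrightarrow> subexponential_growth (g i)) \<Longrightarrow> subexponential_growth (\<lambda>z. \<Sum>i\<in>I. g i z)"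
  by (induction I rule: infinite_finite_induct)
     (auto intro: subexponential_growth_add subexponential_growth_const)

text \<open>
  The mean value inequality on the ball of radius \<open>norm z\<close> costs a factor \<open>norm z\<close>; half of \<open>\<epsilon>\<close>
  pays for the gradient and the other half absorbs this factor.
\<close>

lemma subexponential_growth_of_gradient:
  fixes g :: "real ^ 'n \<Rightarrow> real"
  assumes g: "\<And>z. g differentiable (at z)"
    and growth: "\<And>k. subexponential_growth (partial_deriv k g)"
  shows "subexponential_growth g"
  unfolding subexponential_growth_def
proof (intro allI impI)
  fix e :: real assume "0 < e"
  then have e: "0 < e / 2" by simp
  have "\<exists>C\<ge>0. \<forall>z. \<bar>partial_deriv k g z\<bar> \<le> C * exp (e / 2 * norm z)" for k
    by (rule subexponential_growthE[OF growth e]) blast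
  then obtain C where C: "\<And>k. 0 \<le> C k" "\<And>k z. \<bar>partial_deriv k g z\<bar> \<le> C k * exp (e / 2 * norm z)" by metis
  define K where "K = (\<Sum>k\<in>UNIV. C k)"
  have K: "0 \<le> K" using C by (auto simp: K_def intro: sum_nonneg)
  have "\<bar>g z\<bar> \<le> (\<bar>g 0\<bar> + K * (2 / e)) * exp (e * norm z)" for z
  proof -
    have "norm (g z - g 0) \<le> K * exp (e / 2 * norm z) * norm (z - 0)"
    proof (rule differentiable_bound[of "cball 0 (norm z)"])
      fix x :: "real^'n" assume x: "x \<in> cball 0 (norm z)"
      show "(g has_derivative (\<lambda>v. \<Sum>k\<in>UNIV. v $ k * partial_deriv k g x)) (at x within cball 0 (norm z))"
        using has_derivative_partial_deriv[OF g] by (rule has_derivative_at_withinI)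
      have "onorm (\<lambda>v::real^'n. \<Sum>k\<in>UNIV. v $ k * partial_deriv k g x) \<le> (\<Sum>k\<in>UNIV. \<bar>partial_deriv k g x\<bar>)"
        by (rule onorm_sum_mult_nth_le)
      also have "\<dots> \<le> (\<Sum>k\<in>UNIV. C k * exp (e / 2 * norm x))" by (intro sum_mono C)
      also have "\<dots> \<le> (\<Sum>k\<in>UNIV. C k * exp (e / 2 * norm z))"
        using x e C by (intro sum_mono mult_left_mono) auto
      finally show "onorm (\<lambda>v::real^'n. \<Sum>k\<in>UNIV. v $ k * partial_deriv k g x) \<le> K * exp (e / 2 * norm z)"
        by (simp add: K_def sum_distrib_right)
    qed auto
    also have "\<dots> = K * exp (e / 2 * norm z) * (2 / e) * (e / 2 * norm z)" using e by simp
    also have "\<dots> \<le> K * exp (e / 2 * norm z) * (2 / e) * exp (e / 2 * norm z)"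
      using e K order_trans[OF _ exp_ge_add_one_self[of "e / 2 * norm z"], of "e / 2 * norm z"]
      by (intro mult_left_mono mult_nonneg_nonneg) auto
    also have "\<dots> = K * (2 / e) * exp (e / 2 * norm z + e / 2 * norm z)"
      unfolding exp_add by (simp add: ac_simps)
    finally have "\<bar>g z - g 0\<bar> \<le> K * (2 / e) * exp (e * norm z)" by simp
    moreover have "\<bar>g 0\<bar> * 1 \<le> \<bar>g 0\<bar> * exp (e * norm z)" using e by (intro mult_left_mono) auto
    ultimately show ?thesis unfolding ring_distribs by linarith
  qed
  then show "\<exists>C. \<forall>z. \<bar>g z\<bar> \<le> C * exp (e * norm z)" by blast
qed

section \<open>Functions integrable against every exponential weight\<close>

text \<open>
  The class to which \<open>exp (- r * F)\<close> belongs although it may grow faster than any exponential: all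
  exponential weights are allowed, so that multiplication by functions of subexponential growth
  stays inside the class.
\<close>

definition exp_integrable :: "(real ^ 'n \<Rightarrow> real) \<Rightarrow> bool" where
  "exp_integrable g \<longleftrightarrow> g \<in> borel_measurable borel \<and>
     (\<forall>a. integrable gauss_measure (\<lambda>x. exp (a * norm x) * g x))"

lemma exp_integrable_measurable: "exp_integrable g \<Longrightarrow> g \<in> borel_measurable borel"
  by (simp add: exp_integrable_def)

lemma exp_integrable_integrable: "exp_integrable g \<Longrightarrow> integrable gauss_measure g"
  using spec[of "\<lambda>a. integrable gauss_measure (\<lambda>x. exp (a * norm x) * g x)" 0] by (simp add: exp_integrable_def)

lemma exp_integrable_mult_subexp:
  assumes g: "exp_integrable g" and h: "subexponential_growth h" and [measurable]: "h \<in> borel_measurable borel"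
  shows "exp_integrable (\<lambda>x. g x * h x)"
  unfolding exp_integrable_def
proof (intro conjI allI)
  note [measurable] = exp_integrable_measurable[OF g]
  show "(\<lambda>x. g x * h x) \<in> borel_measurable borel" by measurable
  fix a
  obtain C where C: "0 \<le> C" "\<And>z. \<bar>h z\<bar> \<le> C * exp (1 * norm z)"
    using subexponential_growthE[OF h zero_less_one] by blast
  have "integrable gauss_measure (\<lambda>x. C * (exp ((a + 1) * norm x) * g x))"
    using g unfolding exp_integrable_def by (intro integrable_mult_right) blast
  then show "integrable gauss_measure (\<lambda>x. exp (a * norm x) * (g x * h x))"
  proof (rule Bochner_Integration.integrable_bound)
    show "AE x in gauss_measure. norm (exp (a * norm x) * (g x * h x)) \<le> norm (C * (exp ((a + 1) * norm x) * g x))"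
    proof (rule AE_I2)
      fix x
      have "exp (a * norm x) * \<bar>g x\<bar> * \<bar>h x\<bar> \<le> exp (a * norm x) * \<bar>g x\<bar> * (C * exp (1 * norm x))"
        by (intro mult_left_mono C) auto
      also have "\<dots> = C * (exp ((a + 1) * norm x) * \<bar>g x\<bar>)"
        unfolding ring_distribs exp_add by (simp add: ac_simps)
      finally show "norm (exp (a * norm x) * (g x * h x)) \<le> norm (C * (exp ((a + 1) * norm x) * g x))"
        using C by (simp add: abs_mult)
    qed
  qed measurable
qed

lemma exp_integrable_subexp:
  assumes "subexponential_growth h" "h \<in> borel_measurable borel"
  shows "exp_integrable h"
proof -
  have "exp_integrable (\<lambda>x. 1)" by (simp add: exp_integrable_def integrable_exp_norm_gauss)
  from exp_integrable_mult_subexp[OF this assms] show ?thesis by simp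
qed

text \<open>
  Bound the product of the weight and \<open>exp (p x)\<close> by the sum of their squares; this is why the
  exponential moment is required at \<open>2 * p\<close>.
\<close>

lemma exp_integrable_exp:
  assumes [measurable]: "p \<in> borel_measurable borel"
    and p: "integrable gauss_measure (\<lambda>x. exp (2 * p x))"
  shows "exp_integrable (\<lambda>x. exp (p x))"
  unfolding exp_integrable_def
proof (intro conjI allI)
  fix a
  have "integrable gauss_measure (\<lambda>x. exp (2 * a * norm x) + exp (2 * p x))"
    by (intro Bochner_Integration.integrable_add integrable_exp_norm_gauss p)
  then show "integrable gauss_measure (\<lambda>x. exp (a * norm x) * exp (p x))"
  proof (rule Bochner_Integration.integrable_bound)
    show "AE x in gauss_measure. norm (exp (a * norm x) * exp (p x)) \<le> norm (exp (2 * a * norm x) + exp (2 * p x))"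
    proof (rule AE_I2)
      fix x
      have "0 \<le> (exp (a * norm x) - exp (p x))\<^sup>2 + (exp (a * norm x))\<^sup>2 + (exp (p x))\<^sup>2" by simp
      then have "exp (a * norm x) * exp (p x) \<le> (exp (a * norm x))\<^sup>2 + (exp (p x))\<^sup>2"
        unfolding power2_diff by simp
      then show "norm (exp (a * norm x) * exp (p x)) \<le> norm (exp (2 * a * norm x) + exp (2 * p x))"
        by (simp add: exp_double[symmetric] mult.assoc)
    qed
  qed measurable
qed measurable

section \<open>Averages over Gaussian rotations\<close>

lemma (in pair_sigma_finite) integrable_pair_mult:
  fixes f :: "'a \<Rightarrow> real" and g :: "'b \<Rightarrow> real"
  assumes f: "integrable M1 f" and g: "integrable M2 g"
  shows "integrable (M1 \<Otimes>\<^sub>M M2) (\<lambda>(x, y). f x * g y)"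
proof (rule Fubini_integrable)
  have [measurable]: "f \<in> borel_measurable M1" "g \<in> borel_measurable M2" using f g by auto
  show "(\<lambda>(x, y). f x * g y) \<in> borel_measurable (M1 \<Otimes>\<^sub>M M2)" by measurable
  show "integrable M1 (\<lambda>x. \<integral>y. norm (case (x, y) of (x, y) \<Rightarrow> f x * g y) \<partial>M2)"
    using f by (simp add: abs_mult)
  show "AE x in M1. integrable M2 (\<lambda>y. case (x, y) of (x, y) \<Rightarrow> f x * g y)"
    using g by simp
qed

text \<open>
  The interpolation \<open>\<alpha> *\<^sub>R z + sqrt (1 - \<alpha>\<^sup>2) *\<^sub>R y\<close> is parametrized by the angle with
  \<open>\<alpha> = sin \<theta>\<close>. In this parametrization the path is smooth up to its end points, both coefficients
  are bounded by 1 for all \<open>\<theta>\<close>, and \<open>d\<alpha>\<close> becomes the weight \<open>cos \<theta>\<close>.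
\<close>

definition quarter_circle :: "real measure" where
  "quarter_circle = density lborel (\<lambda>\<theta>. ennreal (indicator {0..pi/2} \<theta>))"

lemma sets_quarter_circle[simp, measurable_cong]: "sets quarter_circle = sets borel"
  by (simp add: quarter_circle_def)

lemma space_quarter_circle[simp]: "space quarter_circle = UNIV"
  by (simp add: quarter_circle_def)

lemma finite_measure_quarter_circle: "finite_measure quarter_circle"
proof
  have "emeasure quarter_circle UNIV = ennreal (pi / 2)"
    by (simp add: quarter_circle_def emeasure_density ennreal_indicator)
  then show "emeasure quarter_circle (space quarter_circle) \<noteq> \<infinity>" by simp
qed

interpretation Q: finite_measure quarter_circle by (rule finite_measure_quarter_circle)
interpretation G: prob_space "gauss_measure :: (real ^ 'n) measure" by (rule prob_space_gauss_measure)
interpretation G2: prob_space "gauss_measure :: ((real ^ 'n) \<times> (real ^ 'n)) measure" by (rule prob_space_gauss_measure)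
interpretation QG: pair_sigma_finite quarter_circle "gauss_measure :: (real ^ 'n) measure" ..
interpretation GG: pair_sigma_finite "gauss_measure :: (real ^ 'n) measure" "gauss_measure :: (real ^ 'n) measure" ..
interpretation QG2: pair_sigma_finite quarter_circle "gauss_measure :: ((real ^ 'n) \<times> (real ^ 'n)) measure" ..

lemma norm_rotate_le: "norm (sin \<theta> *\<^sub>R x + cos \<theta> *\<^sub>R y) \<le> norm x + norm y"
proof -
  have "norm (sin \<theta> *\<^sub>R x + cos \<theta> *\<^sub>R y) \<le> \<bar>sin \<theta>\<bar> * norm x + \<bar>cos \<theta>\<bar> * norm y"
    by (rule order_trans[OF norm_triangle_ineq]) simp
  also have "\<dots> \<le> 1 * norm x + 1 * norm y"
    by (intro add_mono mult_right_mono) auto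
  finally show ?thesis by simp
qed

lemma subexp_rotate_le:
  assumes h: "\<And>z. \<bar>h z\<bar> \<le> C * exp (\<epsilon> * norm z)" and C: "0 \<le> C" "0 \<le> \<epsilon>"
  shows "\<bar>h (sin \<theta> *\<^sub>R x + cos \<theta> *\<^sub>R y)\<bar> \<le> C * exp (\<epsilon> * norm x) * exp (\<epsilon> * norm y)"
proof -
  note h[of "sin \<theta> *\<^sub>R x + cos \<theta> *\<^sub>R y"]
  also have "C * exp (\<epsilon> * norm (sin \<theta> *\<^sub>R x + cos \<theta> *\<^sub>R y)) \<le> C * exp (\<epsilon> * (norm x + norm y))"
    using C by (intro mult_left_mono iffD2[OF exp_le_cancel_iff] norm_rotate_le)
  finally show ?thesis by (simp add: ring_distribs exp_add)
qed

text \<open>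
  The weight \<open>w\<close> is left open because differentiating in \<open>z\<close> multiplies it by \<open>sin\<close>, as
  \<open>has_derivative_rotation_average\<close> shows, so that the derivative is an average of the
  same kind and inherits all bounds.
\<close>

definition rotation_average :: "(real \<Rightarrow> real) \<Rightarrow> (real ^ 'n \<Rightarrow> real) \<Rightarrow> real ^ 'n \<Rightarrow> real" where
  "rotation_average w h z =
     (\<integral>p. w (fst p) * h (sin (fst p) *\<^sub>R z + cos (fst p) *\<^sub>R snd p) \<partial>(quarter_circle \<Otimes>\<^sub>M gauss_measure))"

lemma integrable_rotation_kernel:
  fixes h :: "real ^ 'n \<Rightarrow> real"
  assumes h: "subexponential_growth h" and [measurable]: "h \<in> borel_measurable borel"
    and w: "\<And>\<theta>. \<bar>w \<theta>\<bar> \<le> 1" and [measurable]: "w \<in> borel_measurable borel"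
  shows "integrable (quarter_circle \<Otimes>\<^sub>M gauss_measure) (\<lambda>p. w (fst p) * h (sin (fst p) *\<^sub>R z + cos (fst p) *\<^sub>R snd p))"
proof -
  obtain C where C: "0 \<le> C" "\<And>z. \<bar>h z\<bar> \<le> C * exp (1 * norm z)"
    using subexponential_growthE[OF h zero_less_one] by blast
  have "integrable (quarter_circle \<Otimes>\<^sub>M gauss_measure) (\<lambda>(\<theta>::real, y). (C * exp (1 * norm z)) * exp (1 * norm (y :: real^'n)))"
    by (rule QG.integrable_pair_mult) (rule Q.integrable_const integrable_exp_norm_gauss)+
  then show ?thesis
  proof (rule Bochner_Integration.integrable_bound)
    show "AE p in quarter_circle \<Otimes>\<^sub>M gauss_measure. norm (w (fst p) * h (sin (fst p) *\<^sub>R z + cos (fst p) *\<^sub>R snd p))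
        \<le> norm (case p of (\<theta>::real, y) \<Rightarrow> (C * exp (1 * norm z)) * exp (1 * norm y))"
    proof (rule AE_I2)
      fix p :: "real \<times> (real^'n)"
      have "norm (w (fst p) * h (sin (fst p) *\<^sub>R z + cos (fst p) *\<^sub>R snd p)) \<le> 1 * (C * exp (1 * norm z) * exp (1 * norm (snd p)))"
        unfolding real_norm_def abs_mult by (intro mult_mono w subexp_rotate_le C) auto
      then show "norm (w (fst p) * h (sin (fst p) *\<^sub>R z + cos (fst p) *\<^sub>R snd p))
        \<le> norm (case p of (\<theta>::real, y) \<Rightarrow> (C * exp (1 * norm z)) * exp (1 * norm y))"
        using C(1) by (simp add: case_prod_beta abs_mult)
    qed
  qed measurable
qed

text \<open>
  An exponential bound for \<open>h\<close> splits over the two summands of the rotated point, since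
  \<open>norm (sin \<theta> *\<^sub>R z + cos \<theta> *\<^sub>R y) \<le> norm z + norm y\<close>; the factor in \<open>y\<close> is integrated out.
\<close>

lemma subexponential_growth_rotation_average:
  fixes h :: "real ^ 'n \<Rightarrow> real"
  assumes h: "subexponential_growth h" and [measurable]: "h \<in> borel_measurable borel"
    and w: "\<And>\<theta>. \<bar>w \<theta>\<bar> \<le> 1" and [measurable]: "w \<in> borel_measurable borel"
  shows "subexponential_growth (rotation_average w h)"
  unfolding subexponential_growth_def
proof (intro allI impI)
  fix e :: real assume e: "0 < e"
  obtain C where C: "0 \<le> C" "\<And>z. \<bar>h z\<bar> \<le> C * exp (e * norm z)"
    using subexponential_growthE[OF h e] by blast
  define K where "K = (\<integral>p. exp (e * norm (snd p)) \<partial>(quarter_circle \<Otimes>\<^sub>M (gauss_measure :: (real^'n) measure)))"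
  have "integrable (quarter_circle \<Otimes>\<^sub>M gauss_measure) (\<lambda>(\<theta>::real, y). 1 * exp (e * norm (y :: real^'n)))"
    by (rule QG.integrable_pair_mult) (rule Q.integrable_const integrable_exp_norm_gauss)+
  then have i: "integrable (quarter_circle \<Otimes>\<^sub>M gauss_measure) (\<lambda>p. exp (e * norm (snd p :: real^'n)))"
    by (simp add: case_prod_beta')
  have "\<bar>rotation_average w h z\<bar> \<le> (C * K) * exp (e * norm z)" for z
  proof -
    have "\<bar>rotation_average w h z\<bar> \<le> (\<integral>p. C * exp (e * norm z) * exp (e * norm (snd p)) \<partial>(quarter_circle \<Otimes>\<^sub>M (gauss_measure :: (real^'n) measure)))"
      unfolding rotation_average_def
    proof (rule integral_abs_bound_integral)
      show "integrable (quarter_circle \<Otimes>\<^sub>M gauss_measure) (\<lambda>p. w (fst p) * h (sin (fst p) *\<^sub>R z + cos (fst p) *\<^sub>R snd p))"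
        by (rule integrable_rotation_kernel[OF h _ w]) auto
      show "integrable (quarter_circle \<Otimes>\<^sub>M gauss_measure) (\<lambda>p. C * exp (e * norm z) * exp (e * norm (snd p :: real^'n)))"
        using i by (intro integrable_mult_right)
      fix p :: "real \<times> (real^'n)"
      have "\<bar>w (fst p) * h (sin (fst p) *\<^sub>R z + cos (fst p) *\<^sub>R snd p)\<bar> \<le> 1 * (C * exp (e * norm z) * exp (e * norm (snd p)))"
        unfolding abs_mult using e by (intro mult_mono w subexp_rotate_le C) auto
      then show "\<bar>w (fst p) * h (sin (fst p) *\<^sub>R z + cos (fst p) *\<^sub>R snd p)\<bar> \<le> C * exp (e * norm z) * exp (e * norm (snd p))"
        by simp
    qed
    also have "\<dots> = (C * K) * exp (e * norm z)" by (simp add: K_def)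
    finally show ?thesis .
  qed
  then show "\<exists>C. \<forall>z. \<bar>rotation_average w h z\<bar> \<le> C * exp (e * norm z)" by blast
qed

lemma borel_measurable_rotation_average:
  fixes h :: "real ^ 'n \<Rightarrow> real"
  assumes [measurable]: "h \<in> borel_measurable borel" "w \<in> borel_measurable borel"
  shows "rotation_average w h \<in> borel_measurable borel"
proof -
  show ?thesis unfolding rotation_average_def[abs_def]
    by (intro sigma_finite_measure.borel_measurable_lebesgue_integral[OF QG.sigma_finite_measure_axioms]) measurable
qed

text \<open>
  The average is Frechet differentiable, not only partially: the covariance formula uses the chain
  rule along rotations for functions built from such averages.
\<close>

lemma has_derivative_rotation_average:
  fixes h :: "real ^ 'n \<Rightarrow> real"
  assumes h: "\<And>z. h differentiable (at z)"
    and growth: "\<And>k. subexponential_growth (partial_deriv k h)"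
    and w: "\<And>\<theta>. \<bar>w \<theta>\<bar> \<le> 1" and w_meas: "w \<in> borel_measurable borel"
  shows "(rotation_average w h has_derivative
      (\<lambda>u. \<Sum>k\<in>UNIV. u $ k * rotation_average (\<lambda>\<theta>. w \<theta> * sin \<theta>) (partial_deriv k h) z)) (at z)"
proof -
  let ?P = "quarter_circle \<Otimes>\<^sub>M (gauss_measure :: (real^'n) measure)"
  note [measurable] = w_meas differentiable_imp_borel_measurable[OF h] borel_measurable_partial_deriv[OF h]
  have h_growth: "subexponential_growth h" by (rule subexponential_growth_of_gradient[OF h growth])
  have ws: "\<bar>w \<theta> * sin \<theta>\<bar> \<le> 1" for \<theta>
    unfolding abs_mult using mult_mono[OF w[of \<theta>] abs_sin_le_one[of \<theta>]] by simp
  define rot where "rot p z = sin (fst p) *\<^sub>R z + cos (fst p) *\<^sub>R snd p" for p :: "real \<times> (real^'n)" and z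
  have [measurable]: "(\<lambda>p. rot p z) \<in> borel_measurable ?P" for z unfolding rot_def by measurable
  define H' where "H' z p u = (\<Sum>k\<in>UNIV. u $ k * (w (fst p) * sin (fst p) * partial_deriv k h (rot p z)))"
    for z :: "real^'n" and p u
  obtain C where C: "\<And>k. 0 \<le> C k" "\<And>k z. \<bar>partial_deriv k h z\<bar> \<le> C k * exp (1 * norm z)"
    by (rule subexponential_growth_familyE[of "\<lambda>k. partial_deriv k h" 1]) (use growth in auto)
  \<comment> \<open>points of the closed unit ball around \<open>z\<close> have norm at most \<open>norm z + 1\<close>\<close>
  define B where "B p = (\<Sum>k\<in>UNIV. C k * exp (1 * (norm z + 1)) * exp (1 * norm (snd p)))" for p :: "real \<times> (real^'n)"
  have pd_int: "integrable ?P (\<lambda>p. w (fst p) * sin (fst p) * partial_deriv k h (rot p z))" for k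
    unfolding rot_def by (rule integrable_rotation_kernel[OF growth _ ws]) auto
  have "((\<lambda>z. \<integral>p. w (fst p) * h (rot p z) \<partial>?P) has_derivative (\<lambda>u. \<integral>p. H' z p u \<partial>?P)) (at z within cball z 1)"
  proof (rule has_derivative_integral_dominated)
    show "integrable ?P (\<lambda>p. w (fst p) * h (rot p y))" for y
      unfolding rot_def by (rule integrable_rotation_kernel[OF h_growth _ w]) auto
    show "((\<lambda>z. w (fst p) * h (rot p z)) has_derivative H' y p) (at y within cball z 1)" for y p
    proof -
      have "(rot p has_derivative (\<lambda>u. sin (fst p) *\<^sub>R u)) (at y within cball z 1)"
        unfolding rot_def by (auto intro!: derivative_eq_intros)
      from has_derivative_compose[OF this has_derivative_partial_deriv[OF h]]
      have "((\<lambda>z. w (fst p) * h (rot p z)) has_derivative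
          (\<lambda>u. w (fst p) * (\<Sum>k\<in>UNIV. (sin (fst p) *\<^sub>R u) $ k * partial_deriv k h (rot p y)))) (at y within cball z 1)"
        by (rule has_derivative_mult_right)
      then show ?thesis
        by (simp add: H'_def[abs_def] sum_distrib_left mult_ac)
    qed
    show "onorm (H' y p) \<le> B p" if y: "y \<in> cball z 1" for y p
    proof -
      have ny: "norm y \<le> norm z + 1" using y norm_triangle_ineq2[of y z] by (simp add: dist_norm norm_minus_commute)
      have "onorm (H' y p) \<le> (\<Sum>k\<in>UNIV. \<bar>w (fst p) * sin (fst p) * partial_deriv k h (rot p y)\<bar>)"
        unfolding H'_def[abs_def] by (rule onorm_sum_mult_nth_le)
      also have "\<dots> \<le> B p"
        unfolding B_def
      proof (rule sum_mono)
        fix k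
        have "\<bar>w (fst p) * sin (fst p) * partial_deriv k h (rot p y)\<bar> \<le> 1 * (C k * exp (1 * norm y) * exp (1 * norm (snd p)))"
          unfolding abs_mult[of "w (fst p) * sin (fst p)"] rot_def
          by (intro mult_mono ws subexp_rotate_le C) auto
        also have "\<dots> \<le> C k * exp (1 * (norm z + 1)) * exp (1 * norm (snd p))"
          using ny C by (simp add: mult_left_mono mult_right_mono)
        finally show "\<bar>w (fst p) * sin (fst p) * partial_deriv k h (rot p y)\<bar> \<le> C k * exp (1 * (norm z + 1)) * exp (1 * norm (snd p))" .
      qed
      finally show ?thesis .
    qed
    show "integrable ?P B"
    proof -
      have "integrable ?P (\<lambda>(\<theta>::real, y). c * exp (1 * norm (y :: real^'n)))" for c
        by (rule QG.integrable_pair_mult) (rule Q.integrable_const integrable_exp_norm_gauss)+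
      then show ?thesis unfolding B_def[abs_def] by (intro Bochner_Integration.integrable_sum) (simp add: case_prod_beta')
    qed
    show "(\<lambda>p. H' z p u) \<in> borel_measurable ?P" for u
      unfolding H'_def by measurable
  qed auto
  moreover have "(\<integral>p. H' z p u \<partial>?P) = (\<Sum>k\<in>UNIV. u $ k * rotation_average (\<lambda>\<theta>. w \<theta> * sin \<theta>) (partial_deriv k h) z)" for u
    using pd_int unfolding H'_def rotation_average_def
    by (subst Bochner_Integration.integral_sum) (auto simp: rot_def)
  ultimately show ?thesis
    unfolding rotation_average_def[of w, abs_def] rot_def
    by (simp add: at_within_interior[of z "cball z 1"])
qed

text \<open>
  The expectation depends on \<open>W\<close> through its law, and substituting \<open>\<alpha> = sin \<theta>\<close> turns the
  interpolation of the definition into an average over rotations with weight \<open>cos\<close>.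
\<close>

lemma gaussian_T_eq:
  fixes h :: "real ^ 'n \<Rightarrow> real"
  assumes "prob_space M" and W[measurable]: "W \<in> borel_measurable M" and dist: "distr M borel W = gauss_measure"
    and h: "\<And>z. h differentiable (at z)"
    and growth: "\<And>k. subexponential_growth (partial_deriv k h)"
  shows "gaussian_T M W g h z = (\<Sum>k\<in>UNIV. partial_deriv k g z * rotation_average cos (partial_deriv k h) z)"
proof -
  note pm[measurable] = borel_measurable_partial_deriv[OF h]
  define J where "J k \<alpha> = (\<integral>y. partial_deriv k h (\<alpha> *\<^sub>R z + sqrt (1 - \<alpha>\<^sup>2) *\<^sub>R y) \<partial>gauss_measure)" for k \<alpha>
  have Jm[measurable]: "J k \<in> borel_measurable borel" for k
    unfolding J_def[abs_def] by (intro G.borel_measurable_lebesgue_integral) measurable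
  obtain C where C: "\<And>k. 0 \<le> C k" "\<And>k z. \<bar>partial_deriv k h z\<bar> \<le> C k * exp (1 * norm z)"
    by (rule subexponential_growth_familyE[of "\<lambda>k. partial_deriv k h" 1]) (use growth in auto)
  have bd: "\<bar>partial_deriv k h (\<alpha> *\<^sub>R z + sqrt (1 - \<alpha>\<^sup>2) *\<^sub>R y)\<bar> \<le> C k * exp (1 * norm z) * exp (1 * norm y)"
    if "\<alpha> \<in> {0..1}" for \<alpha> k y
  proof -
    have "\<alpha> = sin (arcsin \<alpha>)" "sqrt (1 - \<alpha>\<^sup>2) = cos (arcsin \<alpha>)"
      using that by (auto simp: cos_arcsin)
    then obtain \<theta> where \<theta>: "\<alpha> = sin \<theta>" "sqrt (1 - \<alpha>\<^sup>2) = cos \<theta>" ..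
    show ?thesis unfolding \<theta>(2) unfolding \<theta>(1)
      using subexp_rotate_le[OF C(2) C(1)] by simp
  qed
  have int_y: "integrable gauss_measure (\<lambda>y. partial_deriv k h (\<alpha> *\<^sub>R z + sqrt (1 - \<alpha>\<^sup>2) *\<^sub>R y))"
    if "\<alpha> \<in> {0..1}" for \<alpha> k
  proof (rule Bochner_Integration.integrable_bound)
    show "integrable gauss_measure (\<lambda>y::real^'n. C k * exp (1 * norm z) * exp (1 * norm y))"
      by (intro integrable_mult_right integrable_exp_norm_gauss)
    show "AE y in gauss_measure. norm (partial_deriv k h (\<alpha> *\<^sub>R z + sqrt (1 - \<alpha>\<^sup>2) *\<^sub>R y)) \<le> norm (C k * exp (1 * norm z) * exp (1 * norm y))"
      using bd[OF that] C(1) by (intro AE_I2) (simp add: abs_mult)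
  qed measurable
  have J_int: "set_integrable lborel {0..1} (J k)" for k
  proof -
    define K where "K = (\<integral>y. C k * exp (1 * norm z) * exp (1 * norm (y::real^'n)) \<partial>gauss_measure)"
    have "\<bar>J k \<alpha>\<bar> \<le> K" if "\<alpha> \<in> {0..1}" for \<alpha>
      unfolding J_def K_def
      by (intro integral_abs_bound_integral int_y that bd integrable_mult_right integrable_exp_norm_gauss)
    then show ?thesis
      unfolding set_integrable_def
      by (intro integrableI_bounded_set_indicator[where B=K]) auto
  qed
  have inner: "(LINT \<omega>|M. (\<Sum>k\<in>UNIV. partial_deriv k g z * partial_deriv k h (\<alpha> *\<^sub>R z + sqrt (1 - \<alpha>\<^sup>2) *\<^sub>R W \<omega>)))
      = (\<Sum>k\<in>UNIV. partial_deriv k g z * J k \<alpha>)" if "\<alpha> \<in> {0..1}" for \<alpha>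
  proof -
    have "(LINT \<omega>|M. (\<Sum>k\<in>UNIV. partial_deriv k g z * partial_deriv k h (\<alpha> *\<^sub>R z + sqrt (1 - \<alpha>\<^sup>2) *\<^sub>R W \<omega>)))
      = (\<integral>y. (\<Sum>k\<in>UNIV. partial_deriv k g z * partial_deriv k h (\<alpha> *\<^sub>R z + sqrt (1 - \<alpha>\<^sup>2) *\<^sub>R y)) \<partial>gauss_measure)"
      unfolding dist[symmetric] by (subst integral_distr) auto
    also have "\<dots> = (\<Sum>k\<in>UNIV. partial_deriv k g z * J k \<alpha>)"
      using int_y[OF that] by (simp add: J_def)
    finally show ?thesis .
  qed
  have J_avg: "(LINT \<alpha>:{0..1}|lborel. J k \<alpha>) = rotation_average cos (partial_deriv k h) z" for k
  proof -
    have "(LINT \<alpha>:{0..1}|lborel. J k \<alpha>) = (LBINT \<alpha>. J k \<alpha> * indicator {sin 0..sin (pi/2)} \<alpha>)"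
      by (simp add: set_lebesgue_integral_def mult.commute)
    also have "\<dots> = (LBINT \<theta>. J k (sin \<theta>) * cos \<theta> * indicator {0..pi/2} \<theta>)"
      using J_int by (intro integral_substitution(2)) (auto intro!: derivative_eq_intros continuous_intros cos_ge_zero)
    also have "\<dots> = (LBINT \<theta>. indicator {0..pi/2} \<theta> * (\<integral>y. cos \<theta> * partial_deriv k h (sin \<theta> *\<^sub>R z + cos \<theta> *\<^sub>R y) \<partial>gauss_measure))"
    proof (intro Bochner_Integration.integral_cong refl)
      fix \<theta> :: real
      have "sqrt (1 - (sin \<theta>)\<^sup>2) = cos \<theta>" if "\<theta> \<in> {0..pi/2}"
        using that by (auto simp: cos_squared_eq[symmetric] cos_ge_zero)
      then show "J k (sin \<theta>) * cos \<theta> * indicator {0..pi/2} \<theta> =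
        indicator {0..pi/2} \<theta> * (\<integral>y. cos \<theta> * partial_deriv k h (sin \<theta> *\<^sub>R z + cos \<theta> *\<^sub>R y) \<partial>gauss_measure)"
        by (auto simp: J_def indicator_def)
    qed
    also have "\<dots> = (\<integral>\<theta>. (\<integral>y. cos \<theta> * partial_deriv k h (sin \<theta> *\<^sub>R z + cos \<theta> *\<^sub>R y) \<partial>gauss_measure) \<partial>quarter_circle)"
      unfolding quarter_circle_def by (subst integral_density) (auto intro!: G.borel_measurable_lebesgue_integral)
    also have "\<dots> = rotation_average cos (partial_deriv k h) z"
    proof -
      have "integrable (quarter_circle \<Otimes>\<^sub>M gauss_measure)
          (\<lambda>p. cos (fst p) * partial_deriv k h (sin (fst p) *\<^sub>R z + cos (fst p) *\<^sub>R snd p))"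
        by (rule integrable_rotation_kernel[OF growth pm abs_cos_le_one]) measurable
      from QG.integral_fst'[OF this] show ?thesis by (simp add: rotation_average_def)
    qed
    finally show ?thesis .
  qed
  have "gaussian_T M W g h z = (LINT \<alpha>:{0..1}|lborel. (\<Sum>k\<in>UNIV. partial_deriv k g z * J k \<alpha>))"
    unfolding gaussian_T_def by (rule set_lebesgue_integral_cong) (use inner in auto)
  also have "\<dots> = (\<Sum>k\<in>UNIV. partial_deriv k g z * (LINT \<alpha>:{0..1}|lborel. J k \<alpha>))"
  proof -
    have "indicator {0..1} \<alpha> *\<^sub>R (\<Sum>k\<in>UNIV. partial_deriv k g z * J k \<alpha>)
        = (\<Sum>k\<in>UNIV. partial_deriv k g z * (indicator {0..1} \<alpha> *\<^sub>R J k \<alpha>))" for \<alpha> :: real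
      unfolding scaleR_sum_right by simp
    then show ?thesis
      using J_int unfolding set_lebesgue_integral_def set_integrable_def by simp
  qed
  finally show ?thesis by (simp add: J_avg)
qed


section \<open>The Gaussian covariance formula\<close>

lemma borel_measurable_component[measurable (raw)]:
  "f \<in> borel_measurable M \<Longrightarrow> (\<lambda>\<omega>. (f \<omega> :: real^'n) $ k) \<in> borel_measurable M"
  by (rule measurable_compose[OF _ borel_measurable_nth])

text \<open>
  The rotated argument mixes \<open>x\<close> and \<open>y\<close>, so \<open>h\<close> and \<open>q\<close> together cost a factor
  \<open>exp (2 * norm x) * exp (2 * norm y)\<close>; the exponential integrability of \<open>p\<close> absorbs the first
  factor and the Gaussian tail the second.
\<close>

lemma integrable_covariance_kernel:
  fixes p h :: "real ^ 'n \<Rightarrow> real" and q :: "real \<times> (real ^ 'n) \<times> (real ^ 'n) \<Rightarrow> real"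
  assumes p: "exp_integrable p" and h: "subexponential_growth h" and [measurable]: "h \<in> borel_measurable borel"
    and q: "\<And>\<theta> x y. \<bar>q (\<theta>, x, y)\<bar> \<le> exp (norm x) * exp (norm y)"
    and [measurable]: "q \<in> borel_measurable (borel \<Otimes>\<^sub>M borel \<Otimes>\<^sub>M borel)"
  shows "integrable (quarter_circle \<Otimes>\<^sub>M (gauss_measure \<Otimes>\<^sub>M gauss_measure))
      (\<lambda>(\<theta>, x, y). p x * h (sin \<theta> *\<^sub>R x + cos \<theta> *\<^sub>R y) * q (\<theta>, x, y))"
proof -
  note [measurable] = exp_integrable_measurable[OF p]
  obtain C where C: "0 \<le> C" "\<And>z. \<bar>h z\<bar> \<le> C * exp (1 * norm z)"
    using subexponential_growthE[OF h zero_less_one] by blast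
  have "integrable gauss_measure (\<lambda>x. exp (2 * norm x) * p x)"
    using p by (simp add: exp_integrable_def)
  then have "integrable (gauss_measure \<Otimes>\<^sub>M gauss_measure)
      (\<lambda>(x, y). (exp (2 * norm x) * p x) * exp (2 * norm (y :: real^'n)))"
    by (rule GG.integrable_pair_mult) (rule integrable_exp_norm_gauss)
  then have "integrable gauss_measure (\<lambda>(x, y). (exp (2 * norm x) * p x) * exp (2 * norm (y :: real^'n)))"
    by (simp add: gauss_measure_pair)
  then have "integrable (quarter_circle \<Otimes>\<^sub>M gauss_measure)
      (\<lambda>(\<theta>, xy). C * (case xy of (x, y) \<Rightarrow> (exp (2 * norm x) * p x) * exp (2 * norm (y :: real^'n))))"
    by (rule QG2.integrable_pair_mult[OF Q.integrable_const])
  then have "integrable (quarter_circle \<Otimes>\<^sub>M (gauss_measure \<Otimes>\<^sub>M gauss_measure))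
      (\<lambda>(\<theta>, xy). C * (case xy of (x, y) \<Rightarrow> (exp (2 * norm x) * p x) * exp (2 * norm (y :: real^'n))))"
    by (simp add: gauss_measure_pair)
  then show ?thesis
  proof (rule Bochner_Integration.integrable_bound)
    show "AE t in quarter_circle \<Otimes>\<^sub>M (gauss_measure \<Otimes>\<^sub>M gauss_measure).
        norm (case t of (\<theta>, x, y) \<Rightarrow> p x * h (sin \<theta> *\<^sub>R x + cos \<theta> *\<^sub>R y) * q (\<theta>, x, y))
        \<le> norm (case t of (\<theta>, xy) \<Rightarrow> C * (case xy of (x, y) \<Rightarrow> (exp (2 * norm x) * p x) * exp (2 * norm y)))"
    proof (rule AE_I2)
      fix t :: "real \<times> (real^'n) \<times> (real^'n)"
      obtain \<theta> x y where t: "t = (\<theta>, x, y)" by (cases t)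
      have "\<bar>p x\<bar> * \<bar>h (sin \<theta> *\<^sub>R x + cos \<theta> *\<^sub>R y)\<bar> * \<bar>q (\<theta>, x, y)\<bar>
          \<le> \<bar>p x\<bar> * (C * exp (1 * norm x) * exp (1 * norm y)) * (exp (norm x) * exp (norm y))"
        by (intro mult_mono order_refl q subexp_rotate_le C) (auto simp: C)
      also have "\<dots> = C * ((exp (norm x))\<^sup>2 * \<bar>p x\<bar> * (exp (norm y))\<^sup>2)"
        by (simp add: power2_eq_square mult_ac)
      finally show "norm (case t of (\<theta>, x, y) \<Rightarrow> p x * h (sin \<theta> *\<^sub>R x + cos \<theta> *\<^sub>R y) * q (\<theta>, x, y))
          \<le> norm (case t of (\<theta>, xy) \<Rightarrow> C * (case xy of (x, y) \<Rightarrow> (exp (2 * norm x) * p x) * exp (2 * norm y)))"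
        using C(1) by (simp add: t abs_mult exp_double)
    qed
  qed measurable
qed

text \<open>
  \<open>A k\<close> sums over \<open>k\<close> to \<open>g x\<close> times the \<open>\<theta>\<close>-derivative of \<open>h\<close> along the rotation from \<open>y\<close> to
  \<open>x\<close>, so its integral is the covariance. For fixed \<open>\<theta>\<close>, integration by parts in the direction
  \<open>u\<close> that leaves the rotated point fixed turns \<open>A k\<close> into \<open>B k\<close>, whose integral is the \<open>k\<close>-th term on
  the right-hand side.
\<close>

lemma gaussian_covariance_formula:
  fixes g h :: "real ^ 'n \<Rightarrow> real"
  assumes g: "\<And>z. g differentiable (at z)" and g_int: "exp_integrable g"
    and pg_int: "\<And>k. exp_integrable (partial_deriv k g)"
    and h: "\<And>z. h differentiable (at z)" and h_growth: "\<And>k. subexponential_growth (partial_deriv k h)"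
  shows "(\<integral>z. g z * h z \<partial>gauss_measure) - integral\<^sup>L gauss_measure g * integral\<^sup>L gauss_measure h =
     (\<integral>z. (\<Sum>k\<in>UNIV. partial_deriv k g z * rotation_average cos (partial_deriv k h) z) \<partial>gauss_measure)"
proof -
  let ?\<gamma> = "gauss_measure :: (real^'n) measure"
  note [measurable] = exp_integrable_measurable[OF g_int] exp_integrable_measurable[OF pg_int]
    differentiable_imp_borel_measurable[OF h] borel_measurable_partial_deriv[OF h]
  have hs: "subexponential_growth h" by (rule subexponential_growth_of_gradient[OF h h_growth])
  define A where "A k = (\<lambda>(\<theta>, x, y). g x * partial_deriv k h (sin \<theta> *\<^sub>R x + cos \<theta> *\<^sub>R y) * (cos \<theta> * x $ k - sin \<theta> * y $ k))" for k
  define B where "B k = (\<lambda>(\<theta>, x, y). partial_deriv k g x * partial_deriv k h (sin \<theta> *\<^sub>R x + cos \<theta> *\<^sub>R y) * cos \<theta>)" for k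
  have A_int: "integrable (quarter_circle \<Otimes>\<^sub>M (?\<gamma> \<Otimes>\<^sub>M ?\<gamma>)) (A k)" for k
  proof -
    have "\<bar>cos \<theta> * x $ k - sin \<theta> * y $ k\<bar> \<le> exp (norm x) * exp (norm y)" for \<theta> and x y :: "real^'n"
    proof -
      have "\<bar>cos \<theta> * x $ k - sin \<theta> * y $ k\<bar> \<le> \<bar>cos \<theta>\<bar> * \<bar>x $ k\<bar> + \<bar>sin \<theta>\<bar> * \<bar>y $ k\<bar>"
        unfolding abs_mult[symmetric] by (rule abs_triangle_ineq4)
      also have "\<dots> \<le> 1 * norm x + 1 * norm y"
        by (intro add_mono mult_mono abs_cos_le_one abs_sin_le_one component_le_norm_cart) auto
      also have "\<dots> \<le> exp (norm x + norm y)"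
        using exp_ge_add_one_self[of "norm x + norm y"] by linarith
      finally show ?thesis by (simp add: exp_add)
    qed
    then show ?thesis unfolding A_def
      by (intro integrable_covariance_kernel[OF g_int h_growth, of _ "\<lambda>(\<theta>, x, y). cos \<theta> * x $ k - sin \<theta> * y $ k", simplified prod.case]) auto
  qed
  have B_int: "integrable (quarter_circle \<Otimes>\<^sub>M (?\<gamma> \<Otimes>\<^sub>M ?\<gamma>)) (B k)" for k
  proof -
    have "\<bar>cos \<theta>\<bar> \<le> exp (norm x) * exp (norm y)" for \<theta> and x y :: "real^'n"
    proof -
      have "\<bar>cos \<theta>\<bar> \<le> 1 * 1" by simp
      also have "\<dots> \<le> exp (norm x) * exp (norm y)" by (intro mult_mono) auto
      finally show ?thesis .
    qed
    then show ?thesis unfolding B_def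
      by (intro integrable_covariance_kernel[OF pg_int h_growth, of _ "\<lambda>(\<theta>, x, y). cos \<theta>", simplified prod.case]) auto
  qed
  interpret Q2: pair_sigma_finite quarter_circle "?\<gamma> \<Otimes>\<^sub>M ?\<gamma>"
    unfolding gauss_measure_pair by (rule QG2.pair_sigma_finite_axioms)
  have cov: "(\<integral>z. g z * h z \<partial>?\<gamma>) - integral\<^sup>L ?\<gamma> g * integral\<^sup>L ?\<gamma> h
      = (\<integral>t. (\<Sum>k\<in>UNIV. A k t) \<partial>(quarter_circle \<Otimes>\<^sub>M (?\<gamma> \<Otimes>\<^sub>M ?\<gamma>)))"
  proof -
    have rot: "((\<lambda>\<theta>. h (sin \<theta> *\<^sub>R x + cos \<theta> *\<^sub>R y)) has_real_derivative
        (\<Sum>k\<in>UNIV. partial_deriv k h (sin \<theta> *\<^sub>R x + cos \<theta> *\<^sub>R y) * (cos \<theta> * x $ k - sin \<theta> * y $ k))) (at \<theta>)" for x y \<theta>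
    proof -
      have "((\<lambda>\<theta>. sin \<theta> *\<^sub>R x + cos \<theta> *\<^sub>R y) has_derivative (\<lambda>r. r *\<^sub>R (cos \<theta> *\<^sub>R x - sin \<theta> *\<^sub>R y))) (at \<theta>)"
        by (auto intro!: derivative_eq_intros simp: algebra_simps)
      from has_derivative_compose[OF this has_derivative_partial_deriv[OF h]] show ?thesis
        by (rule has_derivative_imp_has_field_derivative) (simp add: sum_distrib_left mult_ac)
    qed
    have hg: "integrable ?\<gamma> h" and gi: "integrable ?\<gamma> g" and ghi: "integrable ?\<gamma> (\<lambda>z. g z * h z)"
      using exp_integrable_subexp[OF hs] exp_integrable_mult_subexp[OF g_int hs] g_int
      by (auto intro: exp_integrable_integrable)
    have S: "integrable (quarter_circle \<Otimes>\<^sub>M (?\<gamma> \<Otimes>\<^sub>M ?\<gamma>)) (\<lambda>(\<theta>, xy). \<Sum>k\<in>UNIV. A k (\<theta>, xy))"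
      using A_int by (simp add: case_prod_beta')
    have "(\<integral>t. (\<Sum>k\<in>UNIV. A k t) \<partial>(quarter_circle \<Otimes>\<^sub>M (?\<gamma> \<Otimes>\<^sub>M ?\<gamma>)))
        = (\<integral>xy. (\<integral>\<theta>. (\<Sum>k\<in>UNIV. A k (\<theta>, xy)) \<partial>quarter_circle) \<partial>(?\<gamma> \<Otimes>\<^sub>M ?\<gamma>))"
      using Q2.integral_snd[OF S] by (simp add: case_prod_beta')
    also have "\<dots> = (\<integral>xy. g (fst xy) * (h (fst xy) - h (snd xy)) \<partial>(?\<gamma> \<Otimes>\<^sub>M ?\<gamma>))"
    proof (rule integral_cong_AE)
      show "(\<lambda>xy. \<integral>\<theta>. (\<Sum>k\<in>UNIV. A k (\<theta>, xy)) \<partial>quarter_circle) \<in> borel_measurable (?\<gamma> \<Otimes>\<^sub>M ?\<gamma>)"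
        using Q2.integrable_snd[OF S] by (rule borel_measurable_integrable)
      show "(\<lambda>xy. g (fst xy) * (h (fst xy) - h (snd xy))) \<in> borel_measurable (?\<gamma> \<Otimes>\<^sub>M ?\<gamma>)" by measurable
      show "AE xy in ?\<gamma> \<Otimes>\<^sub>M ?\<gamma>. (\<integral>\<theta>. (\<Sum>k\<in>UNIV. A k (\<theta>, xy)) \<partial>quarter_circle) = g (fst xy) * (h (fst xy) - h (snd xy))"
        using Q2.AE_integrable_snd[OF S]
      proof eventually_elim
        fix xy assume i: "integrable quarter_circle (\<lambda>\<theta>. \<Sum>k\<in>UNIV. A k (\<theta>, xy))"
        obtain x y where xy: "xy = (x, y)" by (cases xy)
        have e: "(\<Sum>k\<in>UNIV. A k (\<theta>, xy)) =
          g x * (\<Sum>k\<in>UNIV. partial_deriv k h (sin \<theta> *\<^sub>R x + cos \<theta> *\<^sub>R y) * (cos \<theta> * x $ k - sin \<theta> * y $ k))" for \<theta>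
          by (simp add: xy A_def sum_distrib_left mult_ac)
        have "((\<lambda>\<theta>. g x * h (sin \<theta> *\<^sub>R x + cos \<theta> *\<^sub>R y)) has_real_derivative (\<Sum>k\<in>UNIV. A k (\<theta>, xy))) (at \<theta>)" for \<theta>
          unfolding e by (rule DERIV_cmult[OF rot])
        from integral_interval_FTC[OF _ this i[unfolded quarter_circle_def]]
        show "(\<integral>\<theta>. (\<Sum>k\<in>UNIV. A k (\<theta>, xy)) \<partial>quarter_circle) = g (fst xy) * (h (fst xy) - h (snd xy))"
          by (simp add: xy right_diff_distrib quarter_circle_def)
      qed
    qed
    also have "\<dots> = (\<integral>x. (\<integral>y. g x * h x * 1 - g x * h y \<partial>?\<gamma>) \<partial>?\<gamma>)"
    proof -
      have "integrable (?\<gamma> \<Otimes>\<^sub>M ?\<gamma>) (\<lambda>p. (case p of (x, y) \<Rightarrow> (g x * h x) * 1) - (case p of (x, y) \<Rightarrow> g x * h y))"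
        by (intro Bochner_Integration.integrable_diff GG.integrable_pair_mult ghi gi hg G.integrable_const)
      from GG.integral_fst'[OF this] show ?thesis by (simp add: case_prod_beta' right_diff_distrib)
    qed
    also have "\<dots> = (\<integral>x. g x * h x - g x * integral\<^sup>L ?\<gamma> h \<partial>?\<gamma>)"
      using hg by (simp add: G.prob_space[simplified])
    also have "\<dots> = (\<integral>z. g z * h z \<partial>?\<gamma>) - integral\<^sup>L ?\<gamma> g * integral\<^sup>L ?\<gamma> h"
      using ghi gi by simp
    finally show ?thesis by simp
  qed
  have AB: "(\<integral>t. A k t \<partial>(quarter_circle \<Otimes>\<^sub>M (?\<gamma> \<Otimes>\<^sub>M ?\<gamma>))) = (\<integral>t. B k t \<partial>(quarter_circle \<Otimes>\<^sub>M (?\<gamma> \<Otimes>\<^sub>M ?\<gamma>)))" for k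
  proof -
    have G_int: "integrable (quarter_circle \<Otimes>\<^sub>M (?\<gamma> \<Otimes>\<^sub>M ?\<gamma>))
        (\<lambda>(\<theta>, x, y). g x * partial_deriv k h (sin \<theta> *\<^sub>R x + cos \<theta> *\<^sub>R y) * 1)"
      using integrable_covariance_kernel[OF g_int h_growth, of k "\<lambda>_. 1"]
      by (simp add: exp_add[symmetric] case_prod_beta')
    have "(\<integral>t. A k t \<partial>(quarter_circle \<Otimes>\<^sub>M (?\<gamma> \<Otimes>\<^sub>M ?\<gamma>))) = (\<integral>\<theta>. (\<integral>xy. A k (\<theta>, xy) \<partial>(?\<gamma> \<Otimes>\<^sub>M ?\<gamma>)) \<partial>quarter_circle)"
      using Q2.integral_fst'[OF A_int] by simp
    also have "\<dots> = (\<integral>\<theta>. (\<integral>xy. B k (\<theta>, xy) \<partial>(?\<gamma> \<Otimes>\<^sub>M ?\<gamma>)) \<partial>quarter_circle)"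
    proof (rule integral_cong_AE)
      show "(\<lambda>\<theta>. \<integral>xy. A k (\<theta>, xy) \<partial>(?\<gamma> \<Otimes>\<^sub>M ?\<gamma>)) \<in> borel_measurable quarter_circle"
        using Q2.integrable_fst'[OF A_int] by (rule borel_measurable_integrable)
      show "(\<lambda>\<theta>. \<integral>xy. B k (\<theta>, xy) \<partial>(?\<gamma> \<Otimes>\<^sub>M ?\<gamma>)) \<in> borel_measurable quarter_circle"
        using Q2.integrable_fst'[OF B_int] by (rule borel_measurable_integrable)
      show "AE \<theta> in quarter_circle. (\<integral>xy. A k (\<theta>, xy) \<partial>(?\<gamma> \<Otimes>\<^sub>M ?\<gamma>)) = (\<integral>xy. B k (\<theta>, xy) \<partial>(?\<gamma> \<Otimes>\<^sub>M ?\<gamma>))"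
        using Q2.AE_integrable_fst'[OF A_int] Q2.AE_integrable_fst'[OF B_int] Q2.AE_integrable_fst'[OF G_int]
      proof eventually_elim
        fix \<theta>
        assume iA: "integrable (?\<gamma> \<Otimes>\<^sub>M ?\<gamma>) (\<lambda>xy. A k (\<theta>, xy))"
          and iB: "integrable (?\<gamma> \<Otimes>\<^sub>M ?\<gamma>) (\<lambda>xy. B k (\<theta>, xy))"
          and iG: "integrable (?\<gamma> \<Otimes>\<^sub>M ?\<gamma>) (\<lambda>xy. case (\<theta>, xy) of (\<theta>, x, y) \<Rightarrow>
             g x * partial_deriv k h (sin \<theta> *\<^sub>R x + cos \<theta> *\<^sub>R y) * 1)"
        \<comment> \<open>the direction along which \<open>sin \<theta> *\<^sub>R x + cos \<theta> *\<^sub>R y\<close> does not change\<close>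
        define u :: "(real^'n) \<times> (real^'n)" where "u = (cos \<theta> *\<^sub>R axis k 1, - (sin \<theta> *\<^sub>R axis k 1))"
        define F where "F xy = g (fst xy) * partial_deriv k h (sin \<theta> *\<^sub>R fst xy + cos \<theta> *\<^sub>R snd xy)" for xy
        have A_eq: "A k (\<theta>, xy) = (xy \<bullet> u) * F xy" for xy
          by (cases xy) (simp add: A_def u_def F_def inner_axis mult_ac)
        have "(\<integral>xy. (xy \<bullet> u) * F xy \<partial>gauss_measure) = (\<integral>xy. B k (\<theta>, xy) \<partial>gauss_measure)"
        proof (rule gaussian_integration_by_parts)
          show "integrable gauss_measure F" using iG by (simp add: F_def[abs_def] gauss_measure_pair case_prod_beta')
          show "integrable gauss_measure (\<lambda>xy. B k (\<theta>, xy))" using iB by (simp add: gauss_measure_pair)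
          show "integrable gauss_measure (\<lambda>xy. (xy \<bullet> u) * F xy)" using iA by (simp add: A_eq gauss_measure_pair)
          fix xy :: "(real^'n) \<times> (real^'n)"
          obtain x y where xy: "xy = (x, y)" by (cases xy)
          have e: "F (xy + r *\<^sub>R u) = g (x + (r * cos \<theta>) *\<^sub>R axis k 1) * partial_deriv k h (sin \<theta> *\<^sub>R x + cos \<theta> *\<^sub>R y)" for r
            by (simp add: F_def xy u_def algebra_simps)
          have "((\<lambda>r. g (x + (r * cos \<theta>) *\<^sub>R axis k 1)) has_real_derivative partial_deriv k g x * cos \<theta>) (at 0)"
            by (rule DERIV_chain2[where f="\<lambda>r. g (x + r *\<^sub>R axis k 1)"])
               (auto intro!: derivative_eq_intros has_real_derivative_partial_deriv[OF g])
          then have "((\<lambda>r. F (xy + r *\<^sub>R u)) has_real_derivative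
              partial_deriv k g x * cos \<theta> * partial_deriv k h (sin \<theta> *\<^sub>R x + cos \<theta> *\<^sub>R y)) (at 0)"
            unfolding e by (rule DERIV_cmult_right)
          then show "((\<lambda>r. F (xy + r *\<^sub>R u)) has_real_derivative B k (\<theta>, xy)) (at 0)"
            by (simp add: B_def xy mult_ac)
        qed
        then show "(\<integral>xy. A k (\<theta>, xy) \<partial>(?\<gamma> \<Otimes>\<^sub>M ?\<gamma>)) = (\<integral>xy. B k (\<theta>, xy) \<partial>(?\<gamma> \<Otimes>\<^sub>M ?\<gamma>))"
          by (simp add: A_eq gauss_measure_pair)
      qed
    qed
    also have "\<dots> = (\<integral>t. B k t \<partial>(quarter_circle \<Otimes>\<^sub>M (?\<gamma> \<Otimes>\<^sub>M ?\<gamma>)))"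
      using Q2.integral_fst'[OF B_int] by simp
    finally show ?thesis .
  qed
  have B_avg: "(\<integral>t. B k t \<partial>(quarter_circle \<Otimes>\<^sub>M (?\<gamma> \<Otimes>\<^sub>M ?\<gamma>)))
      = (\<integral>x. partial_deriv k g x * rotation_average cos (partial_deriv k h) x \<partial>?\<gamma>)" for k
  proof -
    have B': "integrable (quarter_circle \<Otimes>\<^sub>M (?\<gamma> \<Otimes>\<^sub>M ?\<gamma>)) (\<lambda>(\<theta>, xy). B k (\<theta>, xy))"
      using B_int by (simp add: case_prod_beta')
    have B'': "integrable (?\<gamma> \<Otimes>\<^sub>M ?\<gamma>) (\<lambda>xy. \<integral>\<theta>. B k (\<theta>, xy) \<partial>quarter_circle)"
      by (rule Q2.integrable_snd[OF B'])
    have "(\<integral>t. B k t \<partial>(quarter_circle \<Otimes>\<^sub>M (?\<gamma> \<Otimes>\<^sub>M ?\<gamma>)))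
        = (\<integral>xy. (\<integral>\<theta>. B k (\<theta>, xy) \<partial>quarter_circle) \<partial>(?\<gamma> \<Otimes>\<^sub>M ?\<gamma>))"
      using Q2.integral_snd[OF B'] by (simp add: case_prod_beta')
    also have "\<dots> = (\<integral>x. (\<integral>y. (\<integral>\<theta>. B k (\<theta>, x, y) \<partial>quarter_circle) \<partial>?\<gamma>) \<partial>?\<gamma>)"
      using GG.integral_fst'[OF B''] by simp
    also have "\<dots> = (\<integral>x. partial_deriv k g x * rotation_average cos (partial_deriv k h) x \<partial>?\<gamma>)"
    proof (intro Bochner_Integration.integral_cong refl)
      fix x
      have k: "integrable (quarter_circle \<Otimes>\<^sub>M ?\<gamma>) (\<lambda>p. cos (fst p) * partial_deriv k h (sin (fst p) *\<^sub>R x + cos (fst p) *\<^sub>R snd p))"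
        by (rule integrable_rotation_kernel[OF h_growth _ abs_cos_le_one]) measurable
      have e: "(\<lambda>(\<theta>, y). B k (\<theta>, x, y)) = (\<lambda>p. partial_deriv k g x *
          (cos (fst p) * partial_deriv k h (sin (fst p) *\<^sub>R x + cos (fst p) *\<^sub>R snd p)))"
        by (simp add: B_def fun_eq_iff mult_ac)
      have i: "integrable (quarter_circle \<Otimes>\<^sub>M ?\<gamma>) (\<lambda>(\<theta>, y). B k (\<theta>, x, y))"
        unfolding e by (rule integrable_mult_right[OF k])
      show "(\<integral>y. (\<integral>\<theta>. B k (\<theta>, x, y) \<partial>quarter_circle) \<partial>?\<gamma>)
          = partial_deriv k g x * rotation_average cos (partial_deriv k h) x"
        unfolding QG.integral_snd[OF i] e rotation_average_def by simp
    qed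
    finally show ?thesis .
  qed
  have T_int: "integrable ?\<gamma> (\<lambda>x. partial_deriv k g x * rotation_average cos (partial_deriv k h) x)" for k
    by (intro exp_integrable_integrable exp_integrable_mult_subexp[OF pg_int]
          subexponential_growth_rotation_average[OF h_growth _ abs_cos_le_one] borel_measurable_rotation_average) measurable
  show ?thesis
    unfolding cov using A_int T_int by (simp add: AB B_avg)
qed

section \<open>Interpolated gradient products\<close>

text \<open>
  The value of \<open>gaussian_T\<close> in closed form, by \<open>gaussian_T_eq\<close>. Here the probability space does not
  appear, so the operation can be iterated on functions.
\<close>

definition interpolated_gradient_product :: "(real ^ 'n \<Rightarrow> real) \<Rightarrow> (real ^ 'n \<Rightarrow> real) \<Rightarrow> real ^ 'n \<Rightarrow> real" where
  "interpolated_gradient_product g h z =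
     (\<Sum>k\<in>UNIV. partial_deriv k g z * rotation_average cos (partial_deriv k h) z)"

lemma twice_differentiableD:
  assumes "twice_differentiable f"
  shows "f differentiable (at z)" "partial_deriv k f differentiable (at z)"
  using assms by (auto simp: twice_differentiable_def differentiable_on_def)

context
  fixes g h :: "real ^ 'n \<Rightarrow> real"
  assumes g: "twice_differentiable g" and h: "twice_differentiable h"
    and g1: "\<And>k. subexponential_growth (partial_deriv k g)"
    and g2: "\<And>k m. subexponential_growth (partial_deriv m (partial_deriv k g))"
    and h1: "\<And>k. subexponential_growth (partial_deriv k h)"
    and h2: "\<And>k m. subexponential_growth (partial_deriv m (partial_deriv k h))"
begin

lemma has_derivative_interpolated_gradient_product:
  "(interpolated_gradient_product g h has_derivative
     (\<lambda>u. \<Sum>k\<in>UNIV. partial_deriv k g z *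
           (\<Sum>m\<in>UNIV. u $ m * rotation_average (\<lambda>\<theta>. cos \<theta> * sin \<theta>) (partial_deriv m (partial_deriv k h)) z)
         + (\<Sum>m\<in>UNIV. u $ m * partial_deriv m (partial_deriv k g) z) * rotation_average cos (partial_deriv k h) z)) (at z)"
  unfolding interpolated_gradient_product_def[abs_def]
  by (intro has_derivative_sum has_derivative_mult has_derivative_partial_deriv
        has_derivative_rotation_average twice_differentiableD g h h2 abs_cos_le_one) measurable

lemma partial_deriv_interpolated_gradient_product:
  "partial_deriv m (interpolated_gradient_product g h) = (\<lambda>z. \<Sum>k\<in>UNIV.
      partial_deriv k g z * rotation_average (\<lambda>\<theta>. cos \<theta> * sin \<theta>) (partial_deriv m (partial_deriv k h)) z
    + partial_deriv m (partial_deriv k g) z * rotation_average cos (partial_deriv k h) z)"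
  by (rule ext, subst partial_deriv_eqI[OF has_derivative_interpolated_gradient_product])
     (simp add: axis_def if_distrib[of "\<lambda>c. c * _"] cong: if_cong)

lemma differentiable_interpolated_gradient_product:
  "interpolated_gradient_product g h differentiable (at z)"
  using has_derivative_interpolated_gradient_product by (rule differentiableI)

lemma subexponential_growth_partial_deriv_interpolated_gradient_product:
  "subexponential_growth (partial_deriv m (interpolated_gradient_product g h))"
proof -
  have "\<bar>cos \<theta> * sin \<theta>\<bar> \<le> 1" for \<theta> :: real
    unfolding abs_mult using mult_mono[OF abs_cos_le_one[of \<theta>] abs_sin_le_one[of \<theta>]] by simp
  moreover have "cos \<in> borel_measurable (borel :: real measure)"
      "(\<lambda>\<theta>::real. cos \<theta> * sin \<theta>) \<in> borel_measurable borel"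
    by (intro borel_measurable_continuous_onI continuous_intros)+
  moreover have "partial_deriv m (partial_deriv k h) \<in> borel_measurable borel"
      "partial_deriv k h \<in> borel_measurable borel" for k
    by (intro borel_measurable_partial_deriv twice_differentiableD h)+
  ultimately show ?thesis
    unfolding partial_deriv_interpolated_gradient_product
    by (intro subexponential_growth_sum subexponential_growth_add subexponential_growth_mult
          subexponential_growth_rotation_average g1 g2 h1 h2 abs_cos_le_one)
qed

end

section \<open>Exponential tilting\<close>

lemma covariance_eq_interpolated_gradient_product:
  fixes g h :: "real ^ 'n \<Rightarrow> real"
  assumes g: "\<And>z. g differentiable (at z)" and g_growth: "\<And>k. subexponential_growth (partial_deriv k g)"
    and h: "\<And>z. h differentiable (at z)" and h_growth: "\<And>k. subexponential_growth (partial_deriv k h)"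
  shows "(\<integral>z. g z * h z \<partial>gauss_measure) - integral\<^sup>L gauss_measure g * integral\<^sup>L gauss_measure h =
     (\<integral>z. interpolated_gradient_product g h z \<partial>gauss_measure)"
  unfolding interpolated_gradient_product_def
  by (rule gaussian_covariance_formula[OF g
        exp_integrable_subexp[OF subexponential_growth_of_gradient[OF g g_growth] differentiable_imp_borel_measurable[OF g]]
        exp_integrable_subexp[OF g_growth borel_measurable_partial_deriv[OF g]] h h_growth])

text \<open>
  The gradient of the exponential \<open>E\<close> is \<open>E\<close> times a linear combination of the gradients of the
  \<open>f i\<close>, so the covariance formula for \<open>E\<close> and \<open>h\<close> returns \<open>E\<close>-weighted integrals of
  interpolated gradient products.
\<close>

lemma tilted_covariance:
  fixes f :: "'d::finite \<Rightarrow> real ^ 'n \<Rightarrow> real" and h :: "real ^ 'n \<Rightarrow> real" and c m :: "'d \<Rightarrow> real"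
  defines "E \<equiv> (\<lambda>z. exp (\<Sum>i\<in>UNIV. c i * (f i z - m i)))"
  assumes f: "\<And>i z. f i differentiable (at z)" and f_growth: "\<And>i k. subexponential_growth (partial_deriv k (f i))"
    and E: "exp_integrable E"
    and h: "\<And>z. h differentiable (at z)" and h_growth: "\<And>k. subexponential_growth (partial_deriv k h)"
  shows "(\<integral>z. E z * h z \<partial>gauss_measure) - integral\<^sup>L gauss_measure E * integral\<^sup>L gauss_measure h =
     (\<Sum>i\<in>UNIV. c i * (\<integral>z. E z * interpolated_gradient_product (f i) h z \<partial>gauss_measure))"
proof -
  note f_meas = borel_measurable_partial_deriv[OF f]
  have dE: "(E has_derivative (\<lambda>u. E z * (\<Sum>i\<in>UNIV. c i * (\<Sum>k\<in>UNIV. u $ k * partial_deriv k (f i) z)))) (at z)" for z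
    unfolding E_def
    by (auto intro!: derivative_eq_intros has_derivative_partial_deriv[OF f] simp: fun_eq_iff)
  have pE: "partial_deriv k E = (\<lambda>z. E z * (\<Sum>i\<in>UNIV. c i * partial_deriv k (f i) z))" for k
    by (rule ext, subst partial_deriv_eqI[OF dE])
       (simp add: axis_def if_distrib[of "\<lambda>c. c * _"] cong: if_cong)
  have "(\<integral>z. E z * h z \<partial>gauss_measure) - integral\<^sup>L gauss_measure E * integral\<^sup>L gauss_measure h =
     (\<integral>z. (\<Sum>k\<in>UNIV. partial_deriv k E z * rotation_average cos (partial_deriv k h) z) \<partial>gauss_measure)"
  proof (rule gaussian_covariance_formula[OF differentiableI[OF dE] E _ h h_growth])
    show "exp_integrable (partial_deriv k E)" for k
      unfolding pE
      by (intro exp_integrable_mult_subexp E subexponential_growth_sum subexponential_growth_mult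
            subexponential_growth_const f_growth borel_measurable_sum borel_measurable_times borel_measurable_const f_meas)
  qed
  also have "\<dots> = (\<integral>z. (\<Sum>i\<in>UNIV. c i * (E z * interpolated_gradient_product (f i) h z)) \<partial>gauss_measure)"
  proof (intro Bochner_Integration.integral_cong refl)
    fix z
    have "(\<Sum>k\<in>UNIV. partial_deriv k E z * rotation_average cos (partial_deriv k h) z)
       = (\<Sum>k\<in>UNIV. \<Sum>i\<in>UNIV. c i * (E z * (partial_deriv k (f i) z * rotation_average cos (partial_deriv k h) z)))"
      unfolding pE by (simp add: sum_distrib_left sum_distrib_right mult_ac)
    also have "\<dots> = (\<Sum>i\<in>UNIV. \<Sum>k\<in>UNIV. c i * (E z * (partial_deriv k (f i) z * rotation_average cos (partial_deriv k h) z)))"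
      by (rule sum.swap)
    also have "\<dots> = (\<Sum>i\<in>UNIV. c i * (E z * interpolated_gradient_product (f i) h z))"
      by (simp add: interpolated_gradient_product_def sum_distrib_left)
    finally show "(\<Sum>k\<in>UNIV. partial_deriv k E z * rotation_average cos (partial_deriv k h) z)
       = (\<Sum>i\<in>UNIV. c i * (E z * interpolated_gradient_product (f i) h z))" .
  qed
  also have "\<dots> = (\<Sum>i\<in>UNIV. c i * (\<integral>z. E z * interpolated_gradient_product (f i) h z \<partial>gauss_measure))"
  proof -
    have "exp_integrable (\<lambda>z. E z * interpolated_gradient_product (f i) h z)" for i
      unfolding interpolated_gradient_product_def
      by (intro exp_integrable_mult_subexp E subexponential_growth_sum subexponential_growth_mult f_growth
            subexponential_growth_rotation_average h_growth abs_cos_le_one borel_measurable_sum borel_measurable_times f_meas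
            borel_measurable_rotation_average borel_measurable_partial_deriv h) measurable
    then have "integrable gauss_measure (\<lambda>z. E z * interpolated_gradient_product (f i) h z)" for i
      by (rule exp_integrable_integrable)
    then show ?thesis by (simp add: Bochner_Integration.integral_sum)
  qed
  finally show ?thesis .
qed

text \<open>
  The function \<open>\<phi> r * exp (- V * r\<^sup>2 / 2)\<close> has nonpositive derivative.
\<close>

lemma gronwall_quadratic:
  fixes \<phi> :: "real \<Rightarrow> real"
  assumes der: "\<And>r. r \<in> {0..1} \<Longrightarrow> (\<phi> has_real_derivative \<phi>' r) (at r within {0..1})"
    and le: "\<And>r. r \<in> {0..1} \<Longrightarrow> \<phi>' r \<le> r * V * \<phi> r"
  shows "\<phi> 1 \<le> \<phi> 0 * exp (V / 2)"
proof -
  define \<psi> where "\<psi> r = \<phi> r * exp (- V * r\<^sup>2 / 2)" for r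
  have "(\<psi> has_real_derivative (\<phi>' r - r * V * \<phi> r) * exp (- V * r\<^sup>2 / 2)) (at r within {0..1})" if "r \<in> {0..1}" for r
    unfolding \<psi>_def by (auto intro!: derivative_eq_intros der[OF that] simp: algebra_simps)
  then have "\<exists>r\<in>{0..1}. \<psi> 1 - \<psi> 0 = (\<phi>' r - r * V * \<phi> r) * exp (- V * r\<^sup>2 / 2) * (1 - 0)"
    by (intro mvt_very_simple) (auto simp: has_field_derivative_def)
  then obtain r where r: "r \<in> {0..1}" "\<psi> 1 - \<psi> 0 = (\<phi>' r - r * V * \<phi> r) * exp (- V * r\<^sup>2 / 2)" by auto
  have "(\<phi>' r - r * V * \<phi> r) * exp (- V * r\<^sup>2 / 2) \<le> 0"
    using le[OF r(1)] by (intro mult_nonpos_nonneg) auto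
  then have "\<phi> 1 * exp (- V / 2) \<le> \<phi> 0" using r(2) by (simp add: \<psi>_def)
  then have "\<phi> 1 * exp (- V / 2) * exp (V / 2) \<le> \<phi> 0 * exp (V / 2)" by (rule mult_right_mono) simp
  then show ?thesis by (simp add: mult.assoc exp_add[symmetric])
qed

text \<open>
  With \<open>E r = exp (- r * F)\<close> and \<open>\<phi> r\<close> its integral, \<open>tilt\<close> rewrites \<open>\<phi>'\<close> as an \<open>E r\<close>-weighted
  integral of the products \<open>?T i j\<close>; \<open>tilt_T\<close>, where the positivity hypothesis is used,
  replaces these by their unweighted integrals \<open>cov i j\<close> times \<open>\<phi> r\<close>.
\<close>

lemma lower_mgf_bound:
  fixes f :: "'d::finite \<Rightarrow> real ^ 'n \<Rightarrow> real" and \<theta> :: "'d \<Rightarrow> real"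
  defines "m \<equiv> (\<lambda>i. integral\<^sup>L gauss_measure (f i))"
  assumes f: "\<And>i. twice_differentiable (f i)"
    and growth1: "\<And>i k. subexponential_growth (partial_deriv k (f i))"
    and growth2: "\<And>i k j. subexponential_growth (partial_deriv j (partial_deriv k (f i)))"
    and int: "\<And>\<theta> :: 'd \<Rightarrow> real. (\<And>i. 0 \<le> \<theta> i) \<Longrightarrow> integrable gauss_measure (\<lambda>z. exp (- (\<Sum>i\<in>UNIV. \<theta> i * f i z)))"
    and nonneg: "\<And>l i j z. 0 \<le> interpolated_gradient_product (f l) (interpolated_gradient_product (f i) (f j)) z"
    and \<theta>: "\<And>i. 0 \<le> \<theta> i"
  shows "(\<integral>z. exp (- (\<Sum>i\<in>UNIV. \<theta> i * (f i z - m i))) \<partial>gauss_measure)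
     \<le> exp ((\<Sum>i\<in>UNIV. \<Sum>j\<in>UNIV. \<theta> i * \<theta> j * ((\<integral>z. f i z * f j z \<partial>gauss_measure) - m i * m j)) / 2)"
proof -
  let ?\<gamma> = "gauss_measure :: (real^'n) measure"
  let ?T = "\<lambda>i j. interpolated_gradient_product (f i) (f j)"
  note df = twice_differentiableD(1)[OF f]
  have f_meas[measurable]: "f i \<in> borel_measurable borel" for i by (rule differentiable_imp_borel_measurable[OF df])
  have f_growth: "subexponential_growth (f i)" for i by (rule subexponential_growth_of_gradient[OF df growth1])
  define cov where "cov i j = (\<integral>z. f i z * f j z \<partial>?\<gamma>) - m i * m j" for i j
  define V where "V = (\<Sum>i\<in>UNIV. \<Sum>j\<in>UNIV. \<theta> i * \<theta> j * cov i j)"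
  define F where "F z = (\<Sum>i\<in>UNIV. \<theta> i * (f i z - m i))" for z
  have F_meas[measurable]: "F \<in> borel_measurable borel" unfolding F_def[abs_def] by measurable
  have F_growth: "subexponential_growth F"
    unfolding F_def[abs_def] diff_conv_add_uminus
    by (intro subexponential_growth_sum subexponential_growth_mult subexponential_growth_add subexponential_growth_const f_growth)
  define E where "E r z = exp (- r * F z)" for r z
  have E_alt: "E r = (\<lambda>z. exp (\<Sum>i\<in>UNIV. (- r * \<theta> i) * (f i z - m i)))" for r
    by (simp add: E_def F_def sum_distrib_left mult.assoc fun_eq_iff)
  have E_int: "exp_integrable (E r)" if "0 \<le> r" for r
    unfolding E_def[abs_def]
  proof (rule exp_integrable_exp)
    have "exp (2 * (- r * F z)) = exp (2 * r * (\<Sum>i\<in>UNIV. \<theta> i * m i)) * exp (- (\<Sum>i\<in>UNIV. (2 * r * \<theta> i) * f i z))" for z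
    proof -
      have "2 * (- r * F z) = 2 * r * (\<Sum>i\<in>UNIV. \<theta> i * m i) + - (\<Sum>i\<in>UNIV. (2 * r * \<theta> i) * f i z)"
        by (simp add: F_def right_diff_distrib sum_subtractf sum_distrib_left mult.assoc sum_negf)
      then show ?thesis by (simp only: exp_add)
    qed
    then show "integrable ?\<gamma> (\<lambda>z. exp (2 * (- r * F z)))"
      using int[of "\<lambda>i. 2 * r * \<theta> i"] that \<theta> by simp
  qed measurable
  define \<phi> where "\<phi> r = (\<integral>z. E r z \<partial>?\<gamma>)" for r
  have cov_T: "(\<integral>z. ?T i j z \<partial>?\<gamma>) = cov i j" for i j
    unfolding cov_def m_def by (rule covariance_eq_interpolated_gradient_product[OF df growth1 df growth1, symmetric])
  have tilt: "(\<integral>z. E r z * h z \<partial>?\<gamma>) - \<phi> r * integral\<^sup>L ?\<gamma> h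
      = (\<Sum>i\<in>UNIV. - r * \<theta> i * (\<integral>z. E r z * interpolated_gradient_product (f i) h z \<partial>?\<gamma>))"
    if "0 \<le> r" "\<And>z. h differentiable (at z)" "\<And>k. subexponential_growth (partial_deriv k h)" for r h
    unfolding \<phi>_def E_alt
    by (rule tilted_covariance[OF df growth1 E_int[OF that(1), unfolded E_alt] that(2,3)])
  have tilt_T: "(\<integral>z. E r z * ?T i j z \<partial>?\<gamma>) \<le> \<phi> r * cov i j" if r: "0 \<le> r" for r i j
  proof -
    have "(\<integral>z. E r z * ?T i j z \<partial>?\<gamma>) - \<phi> r * cov i j
        = (\<Sum>l\<in>UNIV. - r * \<theta> l * (\<integral>z. E r z * interpolated_gradient_product (f l) (?T i j) z \<partial>?\<gamma>))"
      unfolding cov_T[symmetric]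
      by (rule tilt[OF r
            differentiable_interpolated_gradient_product[OF f f growth1 growth2 growth1 growth2]
            subexponential_growth_partial_deriv_interpolated_gradient_product[OF f f growth1 growth2 growth1 growth2]])
    also have "\<dots> \<le> 0"
      using r \<theta> nonneg
      by (intro sum_nonpos mult_nonpos_nonneg Bochner_Integration.integral_nonneg) (auto simp: E_def)
    finally show ?thesis by simp
  qed
  have \<phi>_der: "(\<phi> has_real_derivative (\<integral>z. - F z * E r z \<partial>?\<gamma>)) (at r within {0..1})" if r: "r \<in> {0..1}" for r
  proof -
    \<comment> \<open>\<open>E r \<le> 1 + E 1\<close> for \<open>r\<close> between 0 and 1, and \<open>\<bar>F\<bar> \<le> F\<^sup>2 + 1\<close>\<close>
    define B where "B z = 1 * (F z * F z + 1) + E 1 z * (F z * F z + 1)" for z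
    have FE: "integrable ?\<gamma> (\<lambda>z. E r z * F z)" if "0 \<le> r" for r
      by (intro exp_integrable_integrable exp_integrable_mult_subexp E_int that F_growth F_meas)
    have "((\<lambda>r. \<integral>z. E r z \<partial>?\<gamma>) has_derivative (\<lambda>u. \<integral>z. u * (- F z * E r z) \<partial>?\<gamma>)) (at r within {0..1})"
    proof (rule has_derivative_integral_dominated)
      show "integrable ?\<gamma> (E s)" if "s \<in> {0..1}" for s
        using that by (intro exp_integrable_integrable E_int) auto
      show "((\<lambda>s. E s z) has_derivative (\<lambda>u. u * (- F z * E s z))) (at s within {0..1})" for s z
        unfolding E_def by (auto intro!: derivative_eq_intros simp: fun_eq_iff)
      show "onorm (\<lambda>u. u * (- F z * E s z)) \<le> B z" if s: "s \<in> {0..1}" for s z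
      proof -
        have "E s z \<le> 1 + E 1 z"
        proof (cases "0 \<le> F z")
          case True
          then have "E s z \<le> 1" using s by (simp add: E_def)
          moreover have "0 \<le> E 1 z" by (simp add: E_def)
          ultimately show ?thesis by linarith
        next
          case False
          then have "s * (- F z) \<le> 1 * (- F z)" using s by (intro mult_right_mono) auto
          then have "E s z \<le> E 1 z" by (simp add: E_def)
          then show ?thesis by simp
        qed
        moreover have "\<bar>F z\<bar> \<le> F z * F z + 1"
        proof -
          have "0 \<le> (\<bar>F z\<bar> - 1)\<^sup>2 + \<bar>F z\<bar>" by simp
          then show ?thesis by (simp add: power2_eq_square algebra_simps)
        qed
        ultimately have "\<bar>F z\<bar> * E s z \<le> (F z * F z + 1) * (1 + E 1 z)"
          by (intro mult_mono) (auto simp: E_def)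
        then have "\<bar>F z\<bar> * E s z \<le> B z" by (simp add: B_def algebra_simps)
        then have "norm (u * (- F z * E s z)) \<le> B z * norm u" for u
          using mult_left_mono[of "\<bar>F z\<bar> * E s z" "B z" "\<bar>u\<bar>"]
          by (simp add: abs_mult mult_ac E_def)
        then show ?thesis by (intro onorm_le)
      qed
      show "integrable ?\<gamma> B"
        unfolding B_def[abs_def]
        by (intro Bochner_Integration.integrable_add exp_integrable_integrable exp_integrable_mult_subexp E_int
              exp_integrable_subexp subexponential_growth_add subexponential_growth_mult subexponential_growth_const F_growth) measurable
      show "(\<lambda>z. u * (- F z * E r z)) \<in> borel_measurable ?\<gamma>" for u
        unfolding E_def by measurable
    qed (use r in auto)
    then show ?thesis
      unfolding \<phi>_def[abs_def]
      by (rule has_derivative_imp_has_field_derivative) simp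
  qed
  have "\<phi> 1 \<le> \<phi> 0 * exp (V / 2)"
  proof (rule gronwall_quadratic[OF \<phi>_der])
    fix r :: real assume "r \<in> {0..1}"
    then have r: "0 \<le> r" by simp
    have Ef: "integrable ?\<gamma> (\<lambda>z. E r z * f j z)" for j
      by (intro exp_integrable_integrable exp_integrable_mult_subexp E_int r f_growth f_meas)
    have E1: "integrable ?\<gamma> (E r)" by (intro exp_integrable_integrable E_int r)
    have "(\<integral>z. - F z * E r z \<partial>?\<gamma>) = (\<integral>z. (\<Sum>j\<in>UNIV. - \<theta> j * (E r z * f j z - E r z * m j)) \<partial>?\<gamma>)"
      unfolding F_def sum_negf[symmetric] sum_distrib_right
      by (intro Bochner_Integration.integral_cong sum.cong refl) (simp add: algebra_simps)
    also have "\<dots> = (\<Sum>j\<in>UNIV. - \<theta> j * ((\<integral>z. E r z * f j z \<partial>?\<gamma>) - \<phi> r * m j))"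
      using Ef E1 by (simp add: \<phi>_def)
    also have "\<dots> = (\<Sum>j\<in>UNIV. \<Sum>i\<in>UNIV. r * (\<theta> i * \<theta> j) * (\<integral>z. E r z * ?T i j z \<partial>?\<gamma>))"
      unfolding m_def tilt[OF r df growth1] by (simp add: sum_distrib_left mult_ac)
    also have "\<dots> \<le> (\<Sum>j\<in>UNIV. \<Sum>i\<in>UNIV. r * (\<theta> i * \<theta> j) * (\<phi> r * cov i j))"
      using r \<theta> by (intro sum_mono mult_left_mono tilt_T) auto
    also have "\<dots> = r * V * \<phi> r"
      unfolding V_def by (subst sum.swap) (simp add: sum_distrib_left sum_distrib_right mult_ac)
    finally show "(\<integral>z. - F z * E r z \<partial>?\<gamma>) \<le> r * V * \<phi> r" .
  qed
  moreover have "\<phi> 0 = 1" by (simp add: \<phi>_def E_def G.prob_space[simplified])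
  ultimately show ?thesis
    by (simp add: \<phi>_def E_def F_def V_def cov_def)
qed

section \<open>Tail bounds\<close>

lemma chernoff_lower_orthant:
  fixes X :: "'d::finite \<Rightarrow> 'a \<Rightarrow> real" and t \<theta> :: "real ^ 'd"
  assumes "prob_space M" and [measurable]: "\<And>i. X i \<in> borel_measurable M"
    and \<theta>: "\<And>i. 0 \<le> \<theta> $ i"
    and int: "integrable M (\<lambda>\<omega>. exp (- (\<Sum>i\<in>UNIV. \<theta> $ i * X i \<omega>)))"
    and le: "(\<integral>\<omega>. exp (- (\<Sum>i\<in>UNIV. \<theta> $ i * X i \<omega>)) \<partial>M) \<le> exp b"
  shows "measure M {\<omega> \<in> space M. \<forall>i. X i \<omega> \<le> - (t $ i)} \<le> exp (b - \<theta> \<bullet> t)"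
proof -
  interpret prob_space M by fact
  define A where "A = {\<omega> \<in> space M. \<forall>i. X i \<omega> \<le> - (t $ i)}"
  have [measurable]: "A \<in> sets M" unfolding A_def by measurable
  have "measure M A = (\<integral>\<omega>. indicator A \<omega> \<partial>M)" by simp
  also have "\<dots> \<le> (\<integral>\<omega>. exp (- (\<theta> \<bullet> t)) * exp (- (\<Sum>i\<in>UNIV. \<theta> $ i * X i \<omega>)) \<partial>M)"
  proof (rule integral_mono)
    show "integrable M (indicator A :: 'a \<Rightarrow> real)" by (simp add: emeasure_eq_measure)
    show "integrable M (\<lambda>\<omega>. exp (- (\<theta> \<bullet> t)) * exp (- (\<Sum>i\<in>UNIV. \<theta> $ i * X i \<omega>)))"
      using int by simp
    fix \<omega>
    show "indicator A \<omega> \<le> exp (- (\<theta> \<bullet> t)) * exp (- (\<Sum>i\<in>UNIV. \<theta> $ i * X i \<omega>))"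
    proof (cases "\<omega> \<in> A")
      case True
      have "(\<Sum>i\<in>UNIV. \<theta> $ i * X i \<omega>) \<le> (\<Sum>i\<in>UNIV. \<theta> $ i * - (t $ i))"
        using True \<theta> by (intro sum_mono mult_left_mono) (auto simp: A_def)
      also have "\<dots> = - (\<theta> \<bullet> t)" by (simp add: inner_vec_def sum_negf)
      finally show ?thesis using True by (simp add: exp_add[symmetric])
    qed (simp add: exp_add[symmetric])
  qed
  also have "\<dots> \<le> exp (- (\<theta> \<bullet> t)) * exp b"
    using le by simp
  also have "\<dots> = exp (b - \<theta> \<bullet> t)"
    by (simp add: exp_add[symmetric])
  finally show ?thesis by (simp add: A_def)
qed

theorem theorem1p1:
  fixes M :: "'a measure"
    and Z Z' :: "'a \<Rightarrow> real ^ 'n"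
    and f :: "'d::finite \<Rightarrow> real ^ 'n \<Rightarrow> real"
    and T2 :: "'d \<Rightarrow> 'd \<Rightarrow> real ^ 'n \<Rightarrow> real"
    and T3 :: "'d \<Rightarrow> 'd \<Rightarrow> 'd \<Rightarrow> real ^ 'n \<Rightarrow> real"
    and \<Sigma> :: "real ^ 'd ^ 'd"
  assumes "prob_space M"
    and "std_gaussian_vector M Z" and "std_gaussian_vector M Z'"
    and "prob_space.indep_var M borel Z borel Z'"
    and "\<And>i. twice_differentiable (f i)"
    and T2_eq: "\<And>i j. T2 i j = gaussian_T M Z' (f i) (f j)"
    and T3_eq: "\<And>l i j. T3 l i j = gaussian_T M Z' (f l) (T2 i j)"
    and "\<And>\<theta> :: 'd \<Rightarrow> real. (\<And>i. 0 \<le> \<theta> i) \<Longrightarrow>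
           integrable M (\<lambda>\<omega>. exp (- (\<Sum>i\<in>UNIV. \<theta> i * f i (Z \<omega>))))"
    and "\<And>i k. subexponential_growth (partial_deriv k (f i))"
    and "\<And>i k m. subexponential_growth (partial_deriv m (partial_deriv k (f i)))"
    and "\<And>l i j z. 0 \<le> T3 l i j z"
    and Sigma_eq: "\<Sigma> = covariance_matrix M (\<lambda>i \<omega>. f i (Z \<omega>))"
  shows "(\<forall>t :: real ^ 'd. (\<forall>i. 0 \<le> t $ i) \<longrightarrow>
            measure M {\<omega> \<in> space M. \<forall>i. f i (Z \<omega>) - (LINT \<omega>'|M. f i (Z \<omega>')) \<le> - (t $ i)}
              \<le> exp (- ((\<Sum>i\<in>UNIV. (t $ i)\<^sup>2) / (2 * onorm ((*v) \<Sigma>)))) \<and>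
            (onorm ((*v) \<Sigma>) = 0 \<and> t \<noteq> 0 \<longrightarrow>
               measure M {\<omega> \<in> space M. \<forall>i. f i (Z \<omega>) - (LINT \<omega>'|M. f i (Z \<omega>')) \<le> - (t $ i)} = 0))
       \<and> (invertible \<Sigma> \<longrightarrow>
           (\<forall>t :: real ^ 'd. (\<forall>i. 0 \<le> (t v* matrix_inv \<Sigma>) $ i) \<longrightarrow>
              measure M {\<omega> \<in> space M. \<forall>i. f i (Z \<omega>) - (LINT \<omega>'|M. f i (Z \<omega>')) \<le> - (t $ i)}
                \<le> exp (- (1 / 2) * ((t v* matrix_inv \<Sigma>) \<bullet> t))))"
proof -
  let ?\<gamma> = "gauss_measure :: (real^'n) measure"
  interpret prob_space M by fact
  note Zm[measurable] = std_gaussian_vector_distr(1)[OF assms(1,2)]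
    and Zd = std_gaussian_vector_distr(2)[OF assms(1,2)]
    and Z'm = std_gaussian_vector_distr(1)[OF assms(1,3)]
    and Z'd = std_gaussian_vector_distr(2)[OF assms(1,3)]
  note f = assms(5) and growth1 = assms(9) and growth2 = assms(10)
  note df = twice_differentiableD(1)[OF f]
  have fm[measurable]: "f i \<in> borel_measurable borel" for i by (rule differentiable_imp_borel_measurable[OF df])
  have fi: "integrable ?\<gamma> (f i)" "integrable ?\<gamma> (\<lambda>z. f i z * f j z)" for i j
  proof -
    have g: "subexponential_growth (f i)" for i by (rule subexponential_growth_of_gradient[OF df growth1])
    show "integrable ?\<gamma> (f i)" "integrable ?\<gamma> (\<lambda>z. f i z * f j z)"
      by (intro exp_integrable_integrable exp_integrable_mult_subexp exp_integrable_subexp g fm)+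
  qed
  have transfer: "(LINT \<omega>|M. g (Z \<omega>)) = integral\<^sup>L ?\<gamma> g"
      "integrable M (\<lambda>\<omega>. g (Z \<omega>)) \<longleftrightarrow> integrable ?\<gamma> g"
    if [measurable]: "g \<in> borel_measurable borel" for g :: "real^'n \<Rightarrow> real"
    unfolding Zd[symmetric] by (simp_all add: integral_distr integrable_distr_eq)
  define m where "m i = integral\<^sup>L ?\<gamma> (f i)" for i
  have mean: "(LINT \<omega>|M. f i (Z \<omega>)) = m i" for i
    by (simp add: transfer m_def)
  have T2: "T2 i j = interpolated_gradient_product (f i) (f j)" for i j
    unfolding T2_eq interpolated_gradient_product_def
    by (rule ext, rule gaussian_T_eq[OF assms(1) Z'm Z'd df growth1])
  have T3: "T3 l i j z = interpolated_gradient_product (f l) (interpolated_gradient_product (f i) (f j)) z" for l i j z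
    unfolding T3_eq T2 interpolated_gradient_product_def[of "f l"]
    by (rule gaussian_T_eq[OF assms(1) Z'm Z'd
          differentiable_interpolated_gradient_product[OF f f growth1 growth2 growth1 growth2]
          subexponential_growth_partial_deriv_interpolated_gradient_product[OF f f growth1 growth2 growth1 growth2]])
  have cov: "\<Sigma> $ i $ j = (\<integral>z. f i z * f j z \<partial>?\<gamma>) - m i * m j" for i j
  proof -
    have "\<Sigma> $ i $ j = (\<integral>z. (f i z - m i) * (f j z - m j) \<partial>?\<gamma>)"
      by (simp add: Sigma_eq covariance_matrix_def mean) (rule transfer(1), measurable)
    also have "\<dots> = (\<integral>z. f i z * f j z - m j * f i z - m i * f j z + m i * m j \<partial>?\<gamma>)"
      by (intro Bochner_Integration.integral_cong refl) (simp add: algebra_simps)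
    also have "\<dots> = (\<integral>z. f i z * f j z \<partial>?\<gamma>) - m i * m j"
      using fi by (simp add: G.prob_space[simplified] m_def)
    finally show ?thesis .
  qed
  have tail: "measure M {\<omega> \<in> space M. \<forall>i. f i (Z \<omega>) - (LINT \<omega>'|M. f i (Z \<omega>')) \<le> - (t $ i)}
      \<le> exp (\<theta> \<bullet> (\<Sigma> *v \<theta>) / 2 - \<theta> \<bullet> t)" if \<theta>: "\<And>i. 0 \<le> \<theta> $ i" for t \<theta> :: "real^'d"
    unfolding mean
  proof (rule chernoff_lower_orthant[OF assms(1) _ \<theta>])
    have e: "exp (- (\<Sum>i\<in>UNIV. \<theta> $ i * (f i z - m i)))
        = exp (\<Sum>i\<in>UNIV. \<theta> $ i * m i) * exp (- (\<Sum>i\<in>UNIV. \<theta> $ i * f i z))" for z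
      by (simp add: exp_add[symmetric] right_diff_distrib sum_subtractf)
    show "integrable M (\<lambda>\<omega>. exp (- (\<Sum>i\<in>UNIV. \<theta> $ i * (f i (Z \<omega>) - m i))))"
      unfolding e using assms(8)[OF \<theta>] by simp
    have "(LINT \<omega>|M. exp (- (\<Sum>i\<in>UNIV. \<theta> $ i * (f i (Z \<omega>) - m i))))
       = (\<integral>z. exp (- (\<Sum>i\<in>UNIV. \<theta> $ i * (f i z - m i))) \<partial>?\<gamma>)"
      by (rule transfer(1)) measurable
    also have "\<dots> \<le> exp ((\<Sum>i\<in>UNIV. \<Sum>j\<in>UNIV. \<theta> $ i * \<theta> $ j * ((\<integral>z. f i z * f j z \<partial>?\<gamma>) - m i * m j)) / 2)"
      unfolding m_def
    proof (rule lower_mgf_bound[OF f growth1 growth2 _ _ \<theta>])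
      show "integrable ?\<gamma> (\<lambda>z. exp (- (\<Sum>i\<in>UNIV. \<theta> i * f i z)))" if "\<And>i. 0 \<le> \<theta> i" for \<theta> :: "'d \<Rightarrow> real"
        using assms(8)[OF that] by (subst transfer(2)[symmetric]) measurable
      show "0 \<le> interpolated_gradient_product (f l) (interpolated_gradient_product (f i) (f j)) z" for l i j z
        using assms(11)[of l i j z] unfolding T3 .
    qed
    also have "(\<Sum>i\<in>UNIV. \<Sum>j\<in>UNIV. \<theta> $ i * \<theta> $ j * ((\<integral>z. f i z * f j z \<partial>?\<gamma>) - m i * m j)) = \<theta> \<bullet> (\<Sigma> *v \<theta>)"
      by (simp add: cov[symmetric] inner_vec_def matrix_vector_mult_def sum_distrib_left mult_ac)
    finally show "(LINT \<omega>|M. exp (- (\<Sum>i\<in>UNIV. \<theta> $ i * (f i (Z \<omega>) - m i)))) \<le> exp (\<theta> \<bullet> (\<Sigma> *v \<theta>) / 2)" .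
  qed measurable
  define L where "L = onorm ((*v) \<Sigma>)"
  have bl: "bounded_linear ((*v) \<Sigma>)" by (rule matrix_vector_mul_bounded_linear)
  have L_nonneg: "0 \<le> L" unfolding L_def by (rule onorm_pos_le[OF bl])
  have quad: "t \<bullet> (\<Sigma> *v t) \<le> L * (t \<bullet> t)" for t
  proof -
    have "t \<bullet> (\<Sigma> *v t) \<le> norm t * norm (\<Sigma> *v t)" by (rule norm_cauchy_schwarz)
    also have "\<dots> \<le> norm t * (L * norm t)" unfolding L_def by (intro mult_left_mono onorm[OF bl]) simp
    also have "\<dots> = L * (t \<bullet> t)" unfolding power2_norm_eq_inner[symmetric] by (simp add: power2_eq_square)
    finally show ?thesis .
  qed
  have "measure M {\<omega> \<in> space M. \<forall>i. f i (Z \<omega>) - (LINT \<omega>'|M. f i (Z \<omega>')) \<le> - (t $ i)}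
          \<le> exp (- ((\<Sum>i\<in>UNIV. (t $ i)\<^sup>2) / (2 * L)))" if t: "\<forall>i. 0 \<le> t $ i" for t :: "real^'d"
  proof (cases "L = 0")
    case True
    then show ?thesis by simp
  next
    case False
    with L_nonneg have L: "0 < L" by simp
    \<comment> \<open>the minimizer of \<open>L * (\<theta> \<bullet> \<theta>) / 2 - \<theta> \<bullet> t\<close>, which dominates the exponent in \<open>tail\<close>\<close>
    let ?\<theta> = "(1 / L) *\<^sub>R t"
    have "measure M {\<omega> \<in> space M. \<forall>i. f i (Z \<omega>) - (LINT \<omega>'|M. f i (Z \<omega>')) \<le> - (t $ i)}
        \<le> exp (?\<theta> \<bullet> (\<Sigma> *v ?\<theta>) / 2 - ?\<theta> \<bullet> t)"
      by (rule tail) (use t L in auto)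
    also have "?\<theta> \<bullet> (\<Sigma> *v ?\<theta>) / 2 - ?\<theta> \<bullet> t \<le> - ((t \<bullet> t) / (2 * L))"
    proof -
      have "?\<theta> \<bullet> (\<Sigma> *v ?\<theta>) \<le> L * (?\<theta> \<bullet> ?\<theta>)" by (rule quad)
      also have "\<dots> = (t \<bullet> t) / L" using L by simp
      finally show ?thesis by (simp add: field_simps)
    qed
    also have "t \<bullet> t = (\<Sum>i\<in>UNIV. (t $ i)\<^sup>2)" by (simp add: inner_vec_def power2_eq_square)
    finally show ?thesis by simp
  qed
  moreover have "measure M {\<omega> \<in> space M. \<forall>i. f i (Z \<omega>) - (LINT \<omega>'|M. f i (Z \<omega>')) \<le> - (t $ i)} = 0" (is "?p = 0")
    if t: "\<forall>i. 0 \<le> t $ i" and "L = 0" "t \<noteq> 0" for t :: "real^'d"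
  proof -
    \<comment> \<open>the quadratic term of the exponent vanishes, so arbitrarily large weights \<open>n *\<^sub>R t\<close> are good\<close>
    have le: "?p \<le> exp (- (t \<bullet> t) * real n)" for n
    proof -
      have "?p \<le> exp ((real n *\<^sub>R t) \<bullet> (\<Sigma> *v (real n *\<^sub>R t)) / 2 - (real n *\<^sub>R t) \<bullet> t)"
        by (rule tail) (use t in auto)
      also have "\<dots> \<le> exp (- (t \<bullet> t) * real n)"
        using quad[of "real n *\<^sub>R t"] \<open>L = 0\<close> by simp
      finally show ?thesis .
    qed
    have "(\<lambda>n. exp (- (t \<bullet> t) * real n)) \<longlonglongrightarrow> 0"
    proof -
      have "t \<bullet> t > 0" using \<open>t \<noteq> 0\<close> by simp
      then have "filterlim (\<lambda>n. - (t \<bullet> t) * real n) at_bot sequentially"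
        by (intro filterlim_tendsto_neg_mult_at_bot[OF tendsto_const _ filterlim_real_sequentially]) simp
      then show ?thesis by (rule filterlim_compose[OF exp_at_bot])
    qed
    then have "?p \<le> 0" by (rule LIMSEQ_le_const) (use le in auto)
    then show ?thesis by (simp add: measure_le_0_iff)
  qed
  moreover have "measure M {\<omega> \<in> space M. \<forall>i. f i (Z \<omega>) - (LINT \<omega>'|M. f i (Z \<omega>')) \<le> - (t $ i)}
        \<le> exp (- (1 / 2) * ((t v* matrix_inv \<Sigma>) \<bullet> t))"
    if inv: "invertible \<Sigma>" and t: "\<forall>i. 0 \<le> (t v* matrix_inv \<Sigma>) $ i" for t :: "real^'d"
  proof -
    let ?\<theta> = "t v* matrix_inv \<Sigma>"
    have "?\<theta> v* \<Sigma> = t"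
    proof -
      have "\<Sigma> ** matrix_inv \<Sigma> = mat 1 \<and> matrix_inv \<Sigma> ** \<Sigma> = mat 1"
        using inv unfolding matrix_inv_def invertible_def by (rule someI_ex)
      then show ?thesis by (simp add: vector_matrix_mul_assoc)
    qed
    then have "?\<theta> \<bullet> (\<Sigma> *v ?\<theta>) = t \<bullet> ?\<theta>"
      by (simp add: dot_lmul_matrix[symmetric])
    then have "?\<theta> \<bullet> (\<Sigma> *v ?\<theta>) / 2 - ?\<theta> \<bullet> t = - (1 / 2) * (?\<theta> \<bullet> t)"
      by (simp add: inner_commute)
    then show ?thesis using tail[of ?\<theta> t] t by simp
  qed
  ultimately show ?thesis unfolding L_def by blast
qed

end
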